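(* Let $W$ be the affine Weyl group of an irreducible reduced crystallographic root system $\Phi$ of rank 2. Let $w\in W$ and $i$ with $\ell(ws_i)<\ell(w)$. Let $\alpha\in\Phi$, $c\in\mathbb{Z}$, $n\ge 1$, and for $t=0,1,\dots,n$ let $r_t$ be the reflection in $H_{\alpha,c+t}$ (so $r_1,\dots,r_n$ is a sequence of adjacent parallel reflections). Suppose that the alcove $w$ lies in the strip between $H_{\alpha,c}$ and $H_{\alpha,c+1}$ (i.e. there is no hyperplane parallel to $H_{r_1}$ strictly between $w$ and $H_{r_1}$), and that for every $1\le t\le n$, $$\ell(r_t\cdots r_1ws_i)=\ell(r_{t-1}\cdots r_1ws_i)+1\quad\text{and}\quad r_t\cdots r_1ws_i\neq r_{t-1}\cdots r_1w.$$ Then $r_n\cdots r_1ws_i\in\mathrm{Annex}(w)$, i.e. $w\not\le r_n\cdots r_1 ws_i$ in Bruhat order.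
   Context: Let $E$ be a Euclidean plane with inner product $\langle\cdot,\cdot\rangle$, $\Phi\subset E$ an irreducible reduced crystallographic root system of rank 2 (type $A_2$, $B_2$ or $G_2$). For $\beta\in\Phi$ put $\beta^\vee=2\beta/\langle\beta,\beta\rangle$; for $k\in\mathbb{Z}$ put $H_{\beta,k}=\{v:\langle v,\beta\rangle=k\}$ and $s_{\beta;k}(v)=v-(\langle v,\beta\rangle-k)\beta^\vee$. The affine Weyl group $W$ generated by these is a Coxeter group with simple generators $s_0,s_1,s_2$, the reflections in the walls of the fundamental alcove $A_0$ ($s_0$ the one whose wall does not contain $0$); alcoves (components of the complement of all $H_{\beta,k}$) are identified with elements of $W$ via $w\mapsto wA_0$. For a reflection $r$, $H_r$ is its fixed hyperplane. $\ell$ is Coxeter length, $\le$ is Bruhat order, and $\mathrm{Annex}(w)=\{y\in W: w\not\le y\}$. (Empty products of reflections equal the identity.) *)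

theory Defs
  imports "HOL-Analysis.Analysis"
begin

definition coroot :: "'a::euclidean_space \<Rightarrow> 'a" where
  "coroot \<beta> = (2 / (\<beta> \<bullet> \<beta>)) *\<^sub>R \<beta>"

definition lin_refl :: "'a::euclidean_space \<Rightarrow> 'a \<Rightarrow> 'a" where
  "lin_refl \<beta> v = v - (v \<bullet> coroot \<beta>) *\<^sub>R \<beta>"

definition root_system :: "'a::euclidean_space set \<Rightarrow> bool" where
  "root_system \<Phi> \<longleftrightarrow>
     finite \<Phi> \<and> 0 \<notin> \<Phi> \<and> span \<Phi> = UNIV \<and>
     (\<forall>\<alpha>\<in>\<Phi>. lin_refl \<alpha> ` \<Phi> = \<Phi>) \<and>
     (\<forall>\<alpha>\<in>\<Phi>. \<forall>\<beta>\<in>\<Phi>. \<beta> \<bullet> coroot \<alpha> \<in> \<int>) \<and>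
     (\<forall>\<alpha>\<in>\<Phi>. \<forall>r::real. r *\<^sub>R \<alpha> \<in> \<Phi> \<longrightarrow> r = 1 \<or> r = -1)"

definition irreducible_rs :: "'a::euclidean_space set \<Rightarrow> bool" where
  "irreducible_rs \<Phi> \<longleftrightarrow> \<Phi> \<noteq> {} \<and>
     \<not> (\<exists>\<Phi>1 \<Phi>2. \<Phi>1 \<noteq> {} \<and> \<Phi>2 \<noteq> {} \<and> \<Phi> = \<Phi>1 \<union> \<Phi>2 \<and>
           (\<forall>\<alpha>\<in>\<Phi>1. \<forall>\<beta>\<in>\<Phi>2. \<alpha> \<bullet> \<beta> = 0))"

definition hyp :: "'a::euclidean_space \<Rightarrow> int \<Rightarrow> 'a set" where
  "hyp \<beta> k = {v. v \<bullet> \<beta> = of_int k}"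

definition aff_refl :: "'a::euclidean_space \<Rightarrow> int \<Rightarrow> 'a \<Rightarrow> 'a" where
  "aff_refl \<beta> k v = v - (v \<bullet> \<beta> - of_int k) *\<^sub>R coroot \<beta>"

text \<open>The affine Weyl group: the group generated by all \<open>s_{\<beta>;k}\<close>
  (the generators are involutions, so the monoid they generate is the group).\<close>
inductive_set affW :: "'a::euclidean_space set \<Rightarrow> ('a \<Rightarrow> 'a) set" for \<Phi> where
  affW_id: "id \<in> affW \<Phi>"
| affW_step: "\<beta> \<in> \<Phi> \<Longrightarrow> w \<in> affW \<Phi> \<Longrightarrow> aff_refl \<beta> k \<circ> w \<in> affW \<Phi>"

text \<open>A vector \<open>\<xi>\<close> is regular if it lies on no root hyperplane through 0;
  it determines the positive system \<open>{\<beta>\<in>\<Phi>. \<langle>\<beta>,\<xi>\<rangle> > 0}\<close>.\<close>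
definition regular_vec :: "'a::euclidean_space set \<Rightarrow> 'a \<Rightarrow> bool" where
  "regular_vec \<Phi> \<xi> \<longleftrightarrow> (\<forall>\<beta>\<in>\<Phi>. \<beta> \<bullet> \<xi> \<noteq> 0)"

definition A0 :: "'a::euclidean_space set \<Rightarrow> 'a \<Rightarrow> 'a set" where
  "A0 \<Phi> \<xi> = {v. \<forall>\<beta>\<in>\<Phi>. \<beta> \<bullet> \<xi> > 0 \<longrightarrow> 0 < v \<bullet> \<beta> \<and> v \<bullet> \<beta> < 1}"

text \<open>Simple generators: reflections in the walls of the fundamental alcove, i.e.
  reflections whose hyperplane meets the closure of \<open>A0\<close> in infinitely many points
  (in the plane: contains a side of the triangle).\<close>
definition simple_refls :: "'a::euclidean_space set \<Rightarrow> 'a \<Rightarrow> ('a \<Rightarrow> 'a) set" where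
  "simple_refls \<Phi> \<xi> =
     {aff_refl \<beta> k | \<beta> k. \<beta> \<in> \<Phi> \<and> infinite (hyp \<beta> k \<inter> closure (A0 \<Phi> \<xi>))}"

definition len :: "'a::euclidean_space set \<Rightarrow> 'a \<Rightarrow> ('a \<Rightarrow> 'a) \<Rightarrow> nat" where
  "len \<Phi> \<xi> w = (LEAST n. \<exists>xs. length xs = n \<and> set xs \<subseteq> simple_refls \<Phi> \<xi> \<and>
                                 w = foldr (\<circ>) xs id)"

definition refls :: "'a::euclidean_space set \<Rightarrow> 'a \<Rightarrow> ('a \<Rightarrow> 'a) set" where
  "refls \<Phi> \<xi> = {u \<circ> s \<circ> inv u | u s. u \<in> affW \<Phi> \<and> s \<in> simple_refls \<Phi> \<xi>}"

definition bruhat_le :: "'a::euclidean_space set \<Rightarrow> 'a \<Rightarrow> ('a \<Rightarrow> 'a) \<Rightarrow> ('a \<Rightarrow> 'a) \<Rightarrow> bool" where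
  "bruhat_le \<Phi> \<xi> u w \<longleftrightarrow> u \<in> affW \<Phi> \<and> w \<in> affW \<Phi> \<and>
     (\<lambda>x y. \<exists>t\<in>refls \<Phi> \<xi>. y = t \<circ> x \<and> len \<Phi> \<xi> x < len \<Phi> \<xi> y)\<^sup>*\<^sup>* u w"

definition annex :: "'a::euclidean_space set \<Rightarrow> 'a \<Rightarrow> ('a \<Rightarrow> 'a) \<Rightarrow> ('a \<Rightarrow> 'a) set" where
  "annex \<Phi> \<xi> w = {y \<in> affW \<Phi>. \<not> bruhat_le \<Phi> \<xi> w y}"

fun rchain :: "'a::euclidean_space \<Rightarrow> int \<Rightarrow> nat \<Rightarrow> 'a \<Rightarrow> 'a" where
  "rchain \<alpha> c 0 = id"
| "rchain \<alpha> c (Suc t) = aff_refl \<alpha> (c + int (Suc t)) \<circ> rchain \<alpha> c t"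

end

theory Submission
  imports Defs
begin

text \<open>Write \<open>x\<^sub>t = r\<^sub>t \<dots> r\<^sub>1 w s\<close>. The proof is an induction on the length of \<open>x\<^sub>n\<close>, driven by a left
  descent \<open>d\<close> of \<open>x\<^sub>n\<close>. If \<open>d\<close> is a left
  descent of every \<open>x\<^sub>t\<close>, it is one of \<open>w\<close> too, and multiplication by \<open>d\<close> from the left gives a
  configuration of the same kind with a shorter end. Otherwise, since each \<open>x\<^sub>t\<close> covers its
  predecessor, \<open>d\<close> is one of the \<open>r\<^sub>t\<close>, and the position of the fundamental alcove forces \<open>d = r\<^sub>1\<close>;
  then \<open>d x\<^sub>1, \<dots>, d x\<^sub>n\<close> is a chain for the same \<open>w\<close> in the direction \<open>- \<alpha>\<close> with one step less. In
  both cases the lifting property of the Bruhat order transfers \<open>w \<le> x\<^sub>n\<close> to the smaller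
  configuration. The length facts come from the set of reflections whose hyperplanes separate a
  point of the fundamental alcove from its image.\<close>

section \<open>Affine reflections\<close>

text \<open>The affine function that cuts out \<open>hyp \<beta> k\<close>. Its sign names the side
  of the line, so that "separated by a line" becomes a negative product of two values.\<close>

definition level :: "'a::euclidean_space \<Rightarrow> int \<Rightarrow> 'a \<Rightarrow> real" where
  "level \<beta> k x = x \<bullet> \<beta> - of_int k"

lemma aff_refl_level: "aff_refl \<beta> k x = x - level \<beta> k x *\<^sub>R coroot \<beta>"
  by (simp add: aff_refl_def level_def)

lemma coroot_uminus: "coroot (- \<beta>) = - coroot \<beta>"
  by (simp add: coroot_def)

lemma coroot_inner_self: "\<beta> \<noteq> 0 \<Longrightarrow> coroot \<beta> \<bullet> \<beta> = 2"
  by (simp add: coroot_def)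

lemma level_uminus: "level (- \<beta>) (- k) x = - level \<beta> k x"
  by (simp add: level_def)

lemma aff_refl_uminus: "aff_refl (- \<beta>) (- k) = aff_refl \<beta> k"
  by (simp add: fun_eq_iff aff_refl_level level_uminus coroot_uminus)

lemma level_self_aff_refl: "\<beta> \<noteq> 0 \<Longrightarrow> level \<beta> k (aff_refl \<beta> k x) = - level \<beta> k x"
  by (simp add: aff_refl_def level_def inner_diff_left coroot_inner_self)

lemma aff_refl_invol: "\<beta> \<noteq> 0 \<Longrightarrow> aff_refl \<beta> k (aff_refl \<beta> k x) = x"
  using level_self_aff_refl[of \<beta> k x] by (simp add: aff_refl_level)

text \<open>Pulling an affine root back along a reflection gives an affine root again; integrality
  of the pairing keeps the new constant an integer.\<close>

lemma level_aff_refl: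
  assumes "\<beta> \<bullet> coroot \<gamma> = of_int j"
  shows "level \<beta> k (aff_refl \<gamma> m x) = level (lin_refl \<gamma> \<beta>) (k - m * j) x"
proof -
  have "coroot \<gamma> \<bullet> \<beta> = of_int j" using assms by (simp add: inner_commute)
  then show ?thesis
    using assms by (simp add: level_def aff_refl_def lin_refl_def algebra_simps inner_commute)
qed

lemma lin_refl_inner_self:
  assumes "\<gamma> \<noteq> 0" shows "lin_refl \<gamma> \<beta> \<bullet> lin_refl \<gamma> \<beta> = \<beta> \<bullet> \<beta>"
  using assms by (simp add: lin_refl_def coroot_def inner_diff_left inner_diff_right inner_commute
      field_simps power2_eq_square)

lemma aff_refl_diff_scaleR:
  "aff_refl \<gamma> m (x - a *\<^sub>R y) = aff_refl \<gamma> m x - a *\<^sub>R (y - (y \<bullet> \<gamma>) *\<^sub>R coroot \<gamma>)"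
  by (simp add: aff_refl_def algebra_simps)

lemma coroot_lin_refl:
  assumes "\<gamma> \<noteq> 0"
  shows "coroot (lin_refl \<gamma> \<beta>) = coroot \<beta> - (coroot \<beta> \<bullet> \<gamma>) *\<^sub>R coroot \<gamma>"
proof -
  have "coroot (lin_refl \<gamma> \<beta>) = (2 / (\<beta> \<bullet> \<beta>)) *\<^sub>R lin_refl \<gamma> \<beta>"
    by (simp add: coroot_def lin_refl_inner_self[OF assms])
  then show ?thesis by (simp add: coroot_def lin_refl_def algebra_simps)
qed

lemma aff_refl_conj:
  assumes "\<gamma> \<noteq> 0" and j: "\<beta> \<bullet> coroot \<gamma> = of_int j"
  shows "aff_refl \<gamma> m (aff_refl \<beta> k x) = aff_refl (lin_refl \<gamma> \<beta>) (k - m * j) (aff_refl \<gamma> m x)"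
proof -
  have "level (lin_refl \<gamma> \<beta>) (k - m * j) (aff_refl \<gamma> m x) = level \<beta> k x"
    using level_aff_refl[OF j, of k m "aff_refl \<gamma> m x"] aff_refl_invol[OF assms(1)] by simp
  then show ?thesis
    unfolding aff_refl_level[of \<beta>] aff_refl_level[of "lin_refl \<gamma> \<beta>"] aff_refl_diff_scaleR
    by (simp add: coroot_lin_refl[OF assms(1)])
qed

lemma level_convex: "level \<beta> k ((1 - u) *\<^sub>R x + u *\<^sub>R y) = (1 - u) * level \<beta> k x + u * level \<beta> k y"
  by (simp add: level_def inner_add_left algebra_simps)

section \<open>Products of words\<close>

definition wprod :: "('a \<Rightarrow> 'a) list \<Rightarrow> 'a \<Rightarrow> 'a" where
  "wprod xs = foldr (\<circ>) xs id"

lemma wprod_Nil: "wprod [] = id"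
  by (simp add: wprod_def)

lemma wprod_Cons: "wprod (x # xs) = x \<circ> wprod xs"
  by (simp add: wprod_def)

lemma wprod_append: "wprod (xs @ ys) = wprod xs \<circ> wprod ys"
  by (induction xs) (simp_all add: wprod_Nil wprod_Cons comp_assoc)

section \<open>Roots, reflections and the group they generate\<close>

locale affine_weyl_plane =
  fixes \<Phi> :: "'a::euclidean_space set" and \<xi> :: 'a
  assumes dim2: "DIM('a) = 2" and rs: "root_system \<Phi>" and reg: "regular_vec \<Phi> \<xi>"
begin

abbreviation "W \<equiv> affW \<Phi>"
abbreviation "S \<equiv> simple_refls \<Phi> \<xi>"
abbreviation "\<ll> \<equiv> len \<Phi> \<xi>"

text \<open>The concrete reflections in root lines, as opposed to \<open>refls\<close>, the
  conjugates of simple reflections. \<open>refls_subset_R\<close> links the two.\<close>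

definition R :: "('a \<Rightarrow> 'a) set" where "R = {aff_refl \<beta> k | \<beta> k. \<beta> \<in> \<Phi>}"

lemma root_nonzero: "\<beta> \<in> \<Phi> \<Longrightarrow> \<beta> \<noteq> 0"
  using rs by (auto simp: root_system_def)

lemma finite_roots: "finite \<Phi>"
  using rs by (auto simp: root_system_def)

lemma root_reduced: "\<beta> \<in> \<Phi> \<Longrightarrow> a *\<^sub>R \<beta> \<in> \<Phi> \<Longrightarrow> a = 1 \<or> a = -1"
  using rs unfolding root_system_def by blast

lemma lin_refl_root: "\<gamma> \<in> \<Phi> \<Longrightarrow> \<beta> \<in> \<Phi> \<Longrightarrow> lin_refl \<gamma> \<beta> \<in> \<Phi>"
  using rs unfolding root_system_def by blast

lemma root_integral:
  assumes "\<gamma> \<in> \<Phi>" "\<beta> \<in> \<Phi>" obtains j where "\<beta> \<bullet> coroot \<gamma> = of_int j"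
  using assms rs unfolding root_system_def Ints_def by blast

lemma uminus_root: "\<beta> \<in> \<Phi> \<Longrightarrow> - \<beta> \<in> \<Phi>"
  using lin_refl_root[of \<beta> \<beta>] root_nonzero[of \<beta>]
  by (simp add: lin_refl_def coroot_def scaleR_2)

lemma W_comp: "u \<in> W \<Longrightarrow> v \<in> W \<Longrightarrow> u \<circ> v \<in> W"
  by (induction rule: affW.induct) (auto simp: comp_assoc intro: affW.intros)

lemma R_subset_W: "r \<in> R \<Longrightarrow> r \<in> W"
  unfolding R_def using affW_step[OF _ affW_id] by fastforce

lemma R_invol: "r \<in> R \<Longrightarrow> r \<circ> r = id"
  by (auto simp: R_def fun_eq_iff aff_refl_invol root_nonzero)

lemma S_subset_R: "s \<in> S \<Longrightarrow> s \<in> R"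
  by (auto simp: simple_refls_def R_def)

lemma W_inverse: "u \<in> W \<Longrightarrow> \<exists>v\<in>W. u \<circ> v = id \<and> v \<circ> u = id"
proof (induction rule: affW.induct)
  case affW_id
  show ?case by (rule bexI[OF _ affW.affW_id]) simp
next
  case (affW_step \<beta> w k)
  then obtain v where v: "v \<in> W" "w \<circ> v = id" "v \<circ> w = id" by blast
  have r: "aff_refl \<beta> k \<in> R" using affW_step by (auto simp: R_def)
  have "(aff_refl \<beta> k \<circ> w) \<circ> (v \<circ> aff_refl \<beta> k) = id" "(v \<circ> aff_refl \<beta> k) \<circ> (aff_refl \<beta> k \<circ> w) = id"
    using v R_invol[OF r] by (simp_all add: fun_eq_iff)
  then show ?case using W_comp[OF v(1) R_subset_W[OF r]] by blast
qed

lemma W_bij: "u \<in> W \<Longrightarrow> bij u"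
  using W_inverse by (metis o_bij)

lemma inv_W: "u \<in> W \<Longrightarrow> inv u \<in> W"
  using W_inverse by (metis inv_unique_comp)

lemma W_inv_simps: "u \<in> W \<Longrightarrow> inv u (u x) = x" "u \<in> W \<Longrightarrow> u (inv u x) = x"
  using W_bij by (simp_all add: bij_is_inj bij_is_surj surj_f_inv_f)

text \<open>The group acts on affine roots: each factor of a product replaces the pair by its image
  under one reflection. The same pair serves for the sides of lines and for conjugation of
  reflections.\<close>

lemma W_push:
  assumes "u \<in> W" "\<beta> \<in> \<Phi>"
  shows "\<exists>\<beta>'\<in>\<Phi>. \<exists>k'. (\<forall>x. level \<beta>' k' (u x) = level \<beta> k x) \<and>
           (\<forall>x. u (aff_refl \<beta> k x) = aff_refl \<beta>' k' (u x))"
  using assms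
proof (induction rule: affW.induct)
  case affW_id
  then show ?case by auto
next
  case (affW_step \<gamma> w m)
  then obtain \<beta>' k' where *: "\<beta>' \<in> \<Phi>" "\<And>x. level \<beta>' k' (w x) = level \<beta> k x"
    "\<And>x. w (aff_refl \<beta> k x) = aff_refl \<beta>' k' (w x)" by blast
  obtain j where j: "\<beta>' \<bullet> coroot \<gamma> = of_int j" using root_integral affW_step * by blast
  have "level (lin_refl \<gamma> \<beta>') (k' - m * j) (aff_refl \<gamma> m (w x)) = level \<beta> k x" for x
    using level_aff_refl[OF j, of k' m "aff_refl \<gamma> m (w x)"] *(2)
      aff_refl_invol[OF root_nonzero[OF affW_step.hyps(1)]] by simp
  moreover have "aff_refl \<gamma> m (w (aff_refl \<beta> k x)) =
      aff_refl (lin_refl \<gamma> \<beta>') (k' - m * j) (aff_refl \<gamma> m (w x))" for x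
    using aff_refl_conj[OF root_nonzero[OF affW_step.hyps(1)] j] *(3) by simp
  ultimately show ?case using lin_refl_root[OF affW_step.hyps(1) *(1)]
    by (intro bexI[of _ "lin_refl \<gamma> \<beta>'"] exI[of _ "k' - m * j"]) auto
qed

lemma W_pull:
  assumes "u \<in> W" "\<beta> \<in> \<Phi>"
  obtains \<beta>' k' where "\<beta>' \<in> \<Phi>" "\<And>x. level \<beta> k (u x) = level \<beta>' k' x"
    "\<And>x. u (aff_refl \<beta>' k' x) = aff_refl \<beta> k (u x)"
proof -
  obtain \<beta>' k' where *: "\<beta>' \<in> \<Phi>" "\<And>x. level \<beta>' k' (inv u x) = level \<beta> k x"
     "\<And>x. inv u (aff_refl \<beta> k x) = aff_refl \<beta>' k' (inv u x)"
    using W_push[OF inv_W[OF assms(1)] assms(2), of k] by blast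
  show ?thesis
  proof
    show "level \<beta> k (u x) = level \<beta>' k' x" for x
      using *(2)[of "u x"] assms(1) by (simp add: W_inv_simps)
    show "u (aff_refl \<beta>' k' x) = aff_refl \<beta> k (u x)" for x
      using *(3)[of "u x"] assms(1) by (metis W_inv_simps)
  qed (rule *)
qed

lemma level_surj: "\<beta> \<noteq> 0 \<Longrightarrow> \<exists>x. level \<beta> k x = a"
  by (rule exI[of _ "((a + of_int k) / (\<beta> \<bullet> \<beta>)) *\<^sub>R \<beta>"]) (simp add: level_def)

text \<open>Evaluation at 0 compares the constants, evaluation at the difference of the two vectors
  compares the gradients.\<close>

lemma level_eqD:
  assumes "\<And>x. level \<beta> k x = level \<gamma> m x" shows "\<beta> = \<gamma> \<and> k = m"
proof -
  have k: "k = m" using assms[of 0] by (simp add: level_def)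
  have "(\<beta> - \<gamma>) \<bullet> (\<beta> - \<gamma>) = 0"
    using assms[of "\<beta> - \<gamma>"] k by (simp add: level_def inner_diff_right)
  then show ?thesis using k by simp
qed

lemma W_push_aff_refl:
  assumes "u \<in> W" "\<beta> \<in> \<Phi>" "\<And>x. level \<beta>' k' (u x) = level \<beta> k x"
  shows "u (aff_refl \<beta> k x) = aff_refl \<beta>' k' (u x)"
proof -
  obtain \<gamma> m where *: "\<And>x. level \<gamma> m (u x) = level \<beta> k x"
    "\<And>x. u (aff_refl \<beta> k x) = aff_refl \<gamma> m (u x)" using W_push[OF assms(1,2)] by blast
  have "level \<gamma> m x = level \<beta>' k' x" for x
    using *(1)[of "inv u x"] assms(3)[of "inv u x"] assms(1) by (simp add: W_inv_simps)
  then show ?thesis using * level_eqD by blast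
qed

lemma R_conj:
  assumes "u \<in> W" "r \<in> R" shows "u \<circ> r \<circ> inv u \<in> R"
proof -
  obtain \<beta> k where r: "r = aff_refl \<beta> k" "\<beta> \<in> \<Phi>" using assms by (auto simp: R_def)
  then obtain \<beta>' k' where "\<beta>' \<in> \<Phi>" "\<And>x. u (aff_refl \<beta> k x) = aff_refl \<beta>' k' (u x)"
    using W_push[OF assms(1)] by blast
  then have "u \<circ> r \<circ> inv u = aff_refl \<beta>' k'" using r assms by (simp add: fun_eq_iff W_inv_simps)
  then show ?thesis using \<open>\<beta>' \<in> \<Phi>\<close> by (auto simp: R_def)
qed

lemma parallel_roots:
  assumes "\<beta> \<in> \<Phi>" "\<gamma> \<in> \<Phi>" "\<gamma> = a *\<^sub>R \<beta>"
  shows "\<gamma> = \<beta> \<or> \<gamma> = - \<beta>"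
  using root_reduced[of \<beta> a] assms by auto

text \<open>A point where the second level is 1 shows that the coroots are proportional, so the
  roots agree up to sign because the system is reduced. The displacement of 0 then settles the
  constants.\<close>

lemma aff_refl_eqD:
  assumes "\<beta> \<in> \<Phi>" "\<gamma> \<in> \<Phi>" "aff_refl \<beta> k = aff_refl \<gamma> m"
  shows "(\<gamma> = \<beta> \<and> m = k) \<or> (\<gamma> = - \<beta> \<and> m = - k)"
proof -
  have eq: "level \<beta> k x *\<^sub>R coroot \<beta> = level \<gamma> m x *\<^sub>R coroot \<gamma>" for x
    using fun_cong[OF assms(3), of x] by (simp add: aff_refl_level)
  have nz: "\<beta> \<noteq> 0" "\<gamma> \<noteq> 0" using assms root_nonzero by auto
  obtain x where "level \<gamma> m x = 1" using level_surj nz by blast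
  then have "coroot \<gamma> = level \<beta> k x *\<^sub>R coroot \<beta>" using eq[of x] by simp
  moreover have "\<gamma> = (\<gamma> \<bullet> \<gamma> / 2) *\<^sub>R coroot \<gamma>" using nz by (simp add: coroot_def)
  ultimately have "\<gamma> = ((\<gamma> \<bullet> \<gamma> / 2) * (level \<beta> k x * (2 / (\<beta> \<bullet> \<beta>)))) *\<^sub>R \<beta>"
    by (metis coroot_def scaleR_scaleR)
  then have "\<gamma> = \<beta> \<or> \<gamma> = - \<beta>" using parallel_roots assms by blast
  then show ?thesis
  proof
    assume "\<gamma> = - \<beta>"
    moreover from this have "(of_int k + of_int m :: real) *\<^sub>R coroot \<beta> = 0"
      using eq[of 0] by (simp add: level_def coroot_uminus scaleR_left_distrib)
        (metis add.right_inverse)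
    ultimately show ?thesis using nz by (simp add: coroot_def)
  qed (use eq[of 0] nz in \<open>simp add: level_def coroot_def\<close>)
qed

end

section \<open>The fundamental alcove and its walls\<close>

context affine_weyl_plane
begin

lemma A0_nonempty: "\<exists>v. v \<in> A0 \<Phi> \<xi>"
proof -
  \<comment> \<open>Dividing \<xi> by a bound on all its pairings with roots puts every positive
    pairing strictly between 0 and 1; the summand 1 makes the bound strict and positive.\<close>
  define M where "M = 1 + (\<Sum>\<beta>\<in>\<Phi>. \<bar>\<beta> \<bullet> \<xi>\<bar>)"
  have M: "M > 0" unfolding M_def by (smt (verit) sum_nonneg abs_ge_zero)
  have le: "\<bar>\<beta> \<bullet> \<xi>\<bar> < M" if "\<beta> \<in> \<Phi>" for \<beta>
    using member_le_sum[OF that, of "\<lambda>\<beta>. \<bar>\<beta> \<bullet> \<xi>\<bar>"] finite_roots by (simp add: M_def)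
  have "(1 / M) *\<^sub>R \<xi> \<in> A0 \<Phi> \<xi>"
    unfolding A0_def using M le by (fastforce simp: inner_commute field_simps)
  then show ?thesis ..
qed

text \<open>A fixed point of the fundamental alcove. The point \<open>w base\<close> represents the
  alcove of \<open>w\<close> in every sign condition below.\<close>

definition base :: 'a where "base = (SOME v. v \<in> A0 \<Phi> \<xi>)"

lemma base_in_A0: "base \<in> A0 \<Phi> \<xi>"
  unfolding base_def using A0_nonempty by (rule someI_ex)

text \<open>On the alcove a positive root takes values strictly between 0 and 1, where there is no
  integer; a negative root reduces to its opposite.\<close>

lemma A0_same_side:
  assumes "v \<in> A0 \<Phi> \<xi>" "v' \<in> A0 \<Phi> \<xi>" "\<beta> \<in> \<Phi>"
  shows "level \<beta> k v * level \<beta> k v' > 0"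
proof -
  have pos: "level \<beta> k v * level \<beta> k v' > 0" if "\<beta> \<in> \<Phi>" "\<beta> \<bullet> \<xi> > 0" for \<beta> k
  proof -
    have "0 < v \<bullet> \<beta>" "v \<bullet> \<beta> < 1" "0 < v' \<bullet> \<beta>" "v' \<bullet> \<beta> < 1" using that assms by (auto simp: A0_def)
    moreover have "real_of_int k \<le> 0 \<or> real_of_int k \<ge> 1" by (cases "k \<le> 0") auto
    ultimately show ?thesis unfolding level_def by (auto intro: mult_pos_pos mult_neg_neg)
  qed
  show ?thesis
  proof (cases "\<beta> \<bullet> \<xi> > 0")
    case False
    then have "- \<beta> \<bullet> \<xi> > 0" using reg assms(3) by (force simp: regular_vec_def)
    then show ?thesis using pos[OF uminus_root[OF assms(3)], of "- k"] by (simp add: level_uminus)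
  qed (use pos assms in blast)
qed

lemma A0_level_nonzero: "v \<in> A0 \<Phi> \<xi> \<Longrightarrow> \<beta> \<in> \<Phi> \<Longrightarrow> level \<beta> k v \<noteq> 0"
  using A0_same_side[of v v \<beta> k] by auto

lemma W_base_level_nonzero: "u \<in> W \<Longrightarrow> \<beta> \<in> \<Phi> \<Longrightarrow> level \<beta> k (u base) \<noteq> 0"
  using A0_level_nonzero[OF base_in_A0] by (metis W_pull)

lemma closure_A0_side:
  assumes "v \<in> closure (A0 \<Phi> \<xi>)" "\<beta> \<in> \<Phi>"
  shows "level \<beta> k v * level \<beta> k base \<ge> 0"
proof -
  have "closed {v. level \<beta> k v * level \<beta> k base \<ge> 0}"
    unfolding level_def by (intro closed_Collect_le continuous_intros)
  then have "closure (A0 \<Phi> \<xi>) \<subseteq> {v. level \<beta> k v * level \<beta> k base \<ge> 0}"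
    by (intro closure_minimal) (use A0_same_side[OF _ base_in_A0 assms(2)] in \<open>auto intro: less_imp_le\<close>)
  then show ?thesis using assms by auto
qed

section \<open>Lines in the plane\<close>

lemma perp_parallel:
  fixes d \<beta> \<gamma> :: 'a
  assumes "d \<noteq> 0" "\<beta> \<noteq> 0" "d \<bullet> \<beta> = 0" "d \<bullet> \<gamma> = 0"
  shows "\<exists>a. \<gamma> = a *\<^sub>R \<beta>"
proof -
  have "dim {x. d \<bullet> x = 0} = 1" using dim_hyperplane[OF assms(1)] dim2 by simp
  then have "{x. d \<bullet> x = 0} \<subseteq> span {\<beta>}"
    using assms by (intro card_ge_dim_independent) auto
  then show ?thesis using assms by (auto simp: span_singleton)
qed

lemma perp_exists: "\<exists>d::'a. d \<noteq> 0 \<and> d \<bullet> \<beta> = 0"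
proof (cases "\<beta> = 0")
  case True
  then show ?thesis by (metis inner_zero_right nonzero_Basis nonempty_Basis ex_in_conv)
next
  case False
  have "dim {x. \<beta> \<bullet> x = 0} \<noteq> 0" using dim_hyperplane[OF False] dim2 by simp
  then show ?thesis unfolding dim_eq_0 by (auto simp: inner_commute)
qed

text \<open>The difference of two common points would be orthogonal to both roots, which makes the
  roots parallel; a common point then makes the two lines equal.\<close>

lemma hyp_inter_unique:
  assumes "\<beta> \<in> \<Phi>" "\<gamma> \<in> \<Phi>" "aff_refl \<beta> k \<noteq> aff_refl \<gamma> m"
    and "level \<beta> k x = 0" "level \<gamma> m x = 0" "level \<beta> k y = 0" "level \<gamma> m y = 0"
  shows "x = y"
proof (rule ccontr)
  assume "x \<noteq> y"
  moreover have "(x - y) \<bullet> \<beta> = 0" "(x - y) \<bullet> \<gamma> = 0"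
    using assms by (simp_all add: level_def inner_diff_left)
  ultimately obtain a where "\<gamma> = a *\<^sub>R \<beta>"
    using perp_parallel[of "x - y" \<beta> \<gamma>] root_nonzero assms by auto
  then have "\<gamma> = \<beta> \<or> \<gamma> = - \<beta>" using parallel_roots assms by blast
  then show False
  proof
    assume "\<gamma> = \<beta>"
    with assms show False by (simp add: level_def)
  next
    assume g: "\<gamma> = - \<beta>"
    then have "m = - k" using assms(4,5) by (simp add: level_def)
    then show False using assms(3) g aff_refl_uminus by metis
  qed
qed

text \<open>Near a point of the wall that lies off the given line, the alcove and its mirror image
  are on the same side of that line. No root line cuts through either of them, so the whole alcoves
  are on the same side.\<close>

lemma simple_separates_only_itself:
  assumes s: "s \<in> S" and \<beta>: "\<beta> \<in> \<Phi>" and neg: "level \<beta> k base * level \<beta> k (s base) < 0"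
  shows "aff_refl \<beta> k = s"
proof (rule ccontr)
  assume ne: "aff_refl \<beta> k \<noteq> s"
  obtain \<gamma> m where g: "s = aff_refl \<gamma> m" "\<gamma> \<in> \<Phi>" "infinite (hyp \<gamma> m \<inter> closure (A0 \<Phi> \<xi>))"
    using s by (auto simp: simple_refls_def)
  \<comment> \<open>The wall has infinitely many points in the closed alcove, and a different line
    meets it in at most one.\<close>
  have "\<exists>q\<in>hyp \<gamma> m \<inter> closure (A0 \<Phi> \<xi>). level \<beta> k q \<noteq> 0"
  proof (rule ccontr)
    assume "\<not> ?thesis"
    then have "x = y" if "x \<in> hyp \<gamma> m \<inter> closure (A0 \<Phi> \<xi>)" "y \<in> hyp \<gamma> m \<inter> closure (A0 \<Phi> \<xi>)" for x y
      using hyp_inter_unique[OF \<beta> g(2), of k m x y] ne g(1) that by (auto simp: hyp_def level_def)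
    then show False using g(3) by (metis finite.emptyI is_singletonI' is_singleton_def finite.insertI)
  qed
  then obtain q where q: "level \<gamma> m q = 0" "q \<in> closure (A0 \<Phi> \<xi>)" "level \<beta> k q \<noteq> 0"
    by (auto simp: hyp_def level_def)
  define h where "h = level \<beta> k base"
  have h: "h \<noteq> 0" using A0_level_nonzero[OF base_in_A0 \<beta>] by (simp add: h_def)
  have sq: "s q = q" using q by (simp add: g aff_refl_level)
  have "level \<beta> k q * h \<ge> 0" using closure_A0_side[OF q(2) \<beta>] by (simp add: h_def)
  then have pos: "level \<beta> k q * h > 0" using h q(3) by (metis less_eq_real_def mult_eq_0_iff)
  \<comment> \<open>The points which, together with their mirror image, are on the side of
    \<open>base\<close>. This is a neighbourhood of the fixed point \<open>q\<close>, so it meets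
    the alcove.\<close>
  define U where "U = {v. 0 < level \<beta> k v * h} \<inter> {v. 0 < level \<beta> k (s v) * h}"
  have "open U" unfolding U_def level_def g aff_refl_def
    by (intro open_Int open_Collect_less continuous_intros)
  moreover have "q \<in> U" using pos sq by (simp add: U_def)
  ultimately obtain q' where q': "q' \<in> A0 \<Phi> \<xi>" "q' \<in> U"
    using q(2) by (metis closure_iff_nhds_not_empty disjoint_iff subset_refl)
  have sW: "s \<in> W" using s S_subset_R R_subset_W by blast
  obtain \<beta>' k' where b: "\<beta>' \<in> \<Phi>" "\<And>x. level \<beta> k (s x) = level \<beta>' k' x"
    using W_pull[OF sW \<beta>] by metis
  have "level \<beta> k (s q') * level \<beta> k (s base) > 0"
    using A0_same_side[OF q'(1) base_in_A0 b(1)] by (simp add: b(2))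
  moreover have "level \<beta> k (s q') * h > 0" using q' by (simp add: U_def)
  ultimately show False using neg unfolding h_def[symmetric]
    by (smt (verit) mult_neg_neg mult_pos_pos zero_less_mult_iff mult_less_0_iff)
qed

section \<open>The alcove as an irredundant intersection of half-planes\<close>

lemma A0_minimal_walls:
  obtains J where "finite J" "J \<subseteq> \<Phi> \<times> UNIV" "A0 \<Phi> \<xi> = {v. \<forall>(\<beta>, k)\<in>J. level \<beta> k v > 0}"
    "\<And>J'. J' \<subset> J \<Longrightarrow> A0 \<Phi> \<xi> \<noteq> {v. \<forall>(\<beta>, k)\<in>J'. level \<beta> k v > 0}"
proof -
  define P where "P J \<longleftrightarrow> finite J \<and> J \<subseteq> \<Phi> \<times> (UNIV::int set) \<and>
      A0 \<Phi> \<xi> = {v. \<forall>(\<beta>, k)\<in>J. level \<beta> k v > 0}" for J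
  \<comment> \<open>The condition that \<beta> is less than 1 is written as positivity of the level
    of the opposite root with constant -1.\<close>
  define C where "C = (\<lambda>\<beta>. (\<beta>, 0::int)) ` {\<beta>\<in>\<Phi>. \<beta> \<bullet> \<xi> > 0} \<union> (\<lambda>\<beta>. (- \<beta>, -1)) ` {\<beta>\<in>\<Phi>. \<beta> \<bullet> \<xi> > 0}"
  have "P C" unfolding P_def C_def using finite_roots uminus_root
    by (auto simp: A0_def level_def ball_Un)
  then obtain J where J: "P J" "\<And>J'. P J' \<Longrightarrow> card J \<le> card J'"
    using ex_has_least_nat[of P C card] by blast
  show ?thesis
  proof (rule that[of J])
    show "A0 \<Phi> \<xi> \<noteq> {v. \<forall>(\<beta>, k)\<in>J'. level \<beta> k v > 0}" if "J' \<subset> J" for J'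
    proof
      assume "A0 \<Phi> \<xi> = {v. \<forall>(\<beta>, k)\<in>J'. level \<beta> k v > 0}"
      then have "P J'" using that J(1) finite_subset unfolding P_def by blast
      then show False using J psubset_card_mono[OF _ that] unfolding P_def
        by (meson leD)
    qed
  qed (use J(1) in \<open>auto simp: P_def\<close>)
qed

text \<open>The segment from the point to \<open>base\<close> lies in the open alcove except perhaps
  at its ends, so its starting point is a limit of alcove points.\<close>

lemma closure_A0_superset:
  assumes J: "A0 \<Phi> \<xi> = {v. \<forall>(\<beta>, k)\<in>J. level \<beta> k v > 0}" and v: "\<forall>(\<beta>, k)\<in>J. level \<beta> k v \<ge> 0"
  shows "v \<in> closure (A0 \<Phi> \<xi>)"
proof -
  define f where "f u = (1 - u) *\<^sub>R v + u *\<^sub>R base" for u :: real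
  have "f u \<in> A0 \<Phi> \<xi>" if u: "0 < u" "u < 1" for u
    unfolding J
  proof clarify
    fix \<beta> k assume bk: "(\<beta>, k) \<in> J"
    have "level \<beta> k base > 0" using bk base_in_A0 J by auto
    moreover have "level \<beta> k v \<ge> 0" using bk v by auto
    ultimately show "level \<beta> k (f u) > 0"
      unfolding f_def level_convex using u by (intro add_nonneg_pos mult_nonneg_nonneg mult_pos_pos) auto
  qed
  then have ev: "eventually (\<lambda>u. f u \<in> closure (A0 \<Phi> \<xi>)) (at_right 0)"
    using closure_subset unfolding eventually_at_right_field by (intro exI[of _ 1]) auto
  have "(f \<longlongrightarrow> f 0) (at_right 0)" unfolding f_def by (intro tendsto_intros)
  then have "(f \<longlongrightarrow> v) (at_right 0)" by (simp add: f_def)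
  then show ?thesis by (intro Lim_in_closed_set[OF closed_closure ev]) simp_all
qed

text \<open>Dropping one inequality of an irredundant system admits a new point \<open>b\<close>.
  The segment from \<open>base\<close> to \<open>b\<close> crosses the line of that inequality where
  all others are strict, so a whole piece of the line bounds the alcove.\<close>

lemma minimal_wall_simple:
  assumes J: "finite J" "J \<subseteq> \<Phi> \<times> UNIV" "A0 \<Phi> \<xi> = {v. \<forall>(\<beta>, k)\<in>J. level \<beta> k v > 0}"
    and min: "\<And>J'. J' \<subset> J \<Longrightarrow> A0 \<Phi> \<xi> \<noteq> {v. \<forall>(\<beta>, k)\<in>J'. level \<beta> k v > 0}"
    and j: "(\<beta>, k) \<in> J"
  shows "aff_refl \<beta> k \<in> S"
proof -
  define J' where "J' = J - {(\<beta>, k)}"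
  have "J' \<subset> J" using j by (auto simp: J'_def)
  then have "A0 \<Phi> \<xi> \<noteq> {v. \<forall>(\<beta>, k)\<in>J'. level \<beta> k v > 0}" by (rule min)
  moreover have "A0 \<Phi> \<xi> \<subseteq> {v. \<forall>(\<beta>, k)\<in>J'. level \<beta> k v > 0}" unfolding J(3) J'_def by auto
  ultimately obtain b where b: "\<forall>(\<beta>, k)\<in>J'. level \<beta> k b > 0" "b \<notin> A0 \<Phi> \<xi>" by blast
  then have bj: "level \<beta> k b \<le> 0" unfolding J(3) J'_def by fastforce
  have base: "\<forall>(\<beta>, k)\<in>J. level \<beta> k base > 0" using base_in_A0 J(3) by auto
  then have basej: "level \<beta> k base > 0" using j by auto
  \<comment> \<open>The parameter at which the level, affine along the segment, vanishes; t = 1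
    occurs when \<open>b\<close> itself is on the line.\<close>
  define t where "t = level \<beta> k base / (level \<beta> k base - level \<beta> k b)"
  have t: "0 < t" "t \<le> 1" using bj basej by (auto simp: t_def field_simps)
  define z where "z = (1 - t) *\<^sub>R base + t *\<^sub>R b"
  have "level \<beta> k z = level \<beta> k base - t * (level \<beta> k base - level \<beta> k b)"
    unfolding z_def level_convex by (simp add: algebra_simps)
  then have zj: "level \<beta> k z = 0" using bj basej by (simp add: t_def)
  have zi: "level \<gamma> m z > 0" if "(\<gamma>, m) \<in> J'" for \<gamma> m
  proof -
    have "level \<gamma> m base > 0" "level \<gamma> m b > 0" using that base b by (auto simp: J'_def)
    then show ?thesis unfolding z_def level_convex using t
      by (intro add_nonneg_pos mult_nonneg_nonneg mult_pos_pos) auto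
  qed
  obtain d where d: "d \<noteq> 0" "d \<bullet> \<beta> = 0" using perp_exists by blast
  \<comment> \<open>Finitely many strict inequalities survive a small move along the line in
    direction \<open>d\<close>.\<close>
  have "eventually (\<lambda>e. \<forall>c\<in>J'. level (fst c) (snd c) (z + e *\<^sub>R d) > 0) (at_right 0)"
  proof (intro eventually_ball_finite ballI)
    show "finite J'" using J(1) by (simp add: J'_def)
    fix c assume c: "c \<in> J'"
    have "((\<lambda>e. level (fst c) (snd c) (z + e *\<^sub>R d)) \<longlongrightarrow> level (fst c) (snd c) (z + 0 *\<^sub>R d)) (at_right 0)"
      unfolding level_def by (intro tendsto_intros)
    then show "eventually (\<lambda>e. level (fst c) (snd c) (z + e *\<^sub>R d) > 0) (at_right 0)"
      by (rule order_tendstoD) (use zi[of "fst c" "snd c"] c in simp)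
  qed
  then obtain e0 :: real where e0: "e0 > 0"
    "\<And>e. 0 < e \<Longrightarrow> e < e0 \<Longrightarrow> \<forall>c\<in>J'. level (fst c) (snd c) (z + e *\<^sub>R d) > 0"
    unfolding eventually_at_right_field by auto
  have "(\<lambda>e. z + e *\<^sub>R d) ` {0<..<e0} \<subseteq> hyp \<beta> k \<inter> closure (A0 \<Phi> \<xi>)"
  proof clarify
    fix e assume e: "e \<in> {0<..<e0}"
    have l: "level \<beta> k (z + e *\<^sub>R d) = 0" using zj d by (simp add: level_def inner_add_left)
    have "z + e *\<^sub>R d \<in> closure (A0 \<Phi> \<xi>)"
    proof (rule closure_A0_superset[OF J(3)], clarify)
      fix \<gamma> m assume "(\<gamma>, m) \<in> J"
      then consider "(\<gamma>, m) = (\<beta>, k)" | "(\<gamma>, m) \<in> J'" by (auto simp: J'_def)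
      then show "0 \<le> level \<gamma> m (z + e *\<^sub>R d)" using e0(2)[of e] e l by cases force+
    qed
    then show "z + e *\<^sub>R d \<in> hyp \<beta> k \<inter> closure (A0 \<Phi> \<xi>)" using l by (simp add: hyp_def level_def)
  qed
  moreover have "infinite ((\<lambda>e. z + e *\<^sub>R d) ` {0<..<e0})"
    using e0(1) d by (subst finite_image_iff) (auto simp: inj_on_def)
  ultimately have "infinite (hyp \<beta> k \<inter> closure (A0 \<Phi> \<xi>))" using finite_subset by blast
  then show ?thesis using j J(2) unfolding simple_refls_def by blast
qed

end

section \<open>Generation by simple reflections\<close>

context affine_weyl_plane
begin

text \<open>A set of affine functions, so each separating line counts twice, once per sign. The
  point may lie on root lines. The cardinality is the measure for moving a point into the closed
  alcove.\<close>

definition separating :: "'a \<Rightarrow> ('a \<Rightarrow> real) set" where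
  "separating x = {f. (\<exists>\<beta>\<in>\<Phi>. \<exists>k. f = level \<beta> k) \<and> f base * f x < 0}"

lemma finite_separating: "finite (separating x)"
proof -
  define K where "K \<beta> = {\<lfloor>min (base \<bullet> \<beta>) (x \<bullet> \<beta>)\<rfloor>..\<lceil>max (base \<bullet> \<beta>) (x \<bullet> \<beta>)\<rceil>}" for \<beta>
  have "separating x \<subseteq> (\<lambda>(\<beta>, k). level \<beta> k) ` (SIGMA \<beta>:\<Phi>. K \<beta>)"
  proof
    fix f assume "f \<in> separating x"
    then obtain \<beta> k where f: "\<beta> \<in> \<Phi>" "f = level \<beta> k" "level \<beta> k base * level \<beta> k x < 0"
      by (auto simp: separating_def)
    then have "min (base \<bullet> \<beta>) (x \<bullet> \<beta>) \<le> of_int k" "of_int k \<le> max (base \<bullet> \<beta>) (x \<bullet> \<beta>)"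
      by (auto simp: level_def mult_less_0_iff)
    then have "k \<in> K \<beta>" unfolding K_def by (simp add: floor_le_iff le_ceiling_iff)
    then show "f \<in> (\<lambda>(\<beta>, k). level \<beta> k) ` (SIGMA \<beta>:\<Phi>. K \<beta>)" using f by force
  qed
  then show ?thesis
    by (rule finite_subset) (use finite_roots in \<open>auto simp: K_def\<close>)
qed

text \<open>Composition with \<open>s\<close> maps the functions for \<open>s x\<close> injectively
  to those for \<open>x\<close>, since \<open>s\<close> moves \<open>base\<close> across its own
  wall only. The level of that wall is not in the image, hence the strict inequality.\<close>

lemma separating_simple_less:
  assumes s: "s = aff_refl \<gamma> m" "s \<in> S" and \<gamma>: "\<gamma> \<in> \<Phi>"
    and x: "level \<gamma> m base > 0" "level \<gamma> m x < 0"
  shows "card (separating (s x)) < card (separating x)"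
proof -
  have sW: "s \<in> W" using s S_subset_R R_subset_W by blast
  have inv: "s (s y) = y" for y using R_invol[OF S_subset_R[OF s(2)]] by (simp add: fun_eq_iff)
  have lev: "level \<gamma> m (s y) = - level \<gamma> m y" for y
    unfolding s by (rule level_self_aff_refl) (rule root_nonzero[OF \<gamma>])
  have "(\<lambda>f. f \<circ> s) ` separating (s x) \<subseteq> separating x - {level \<gamma> m}"
  proof clarify
    fix f assume "f \<in> separating (s x)"
    then obtain \<beta> k where f: "\<beta> \<in> \<Phi>" "f = level \<beta> k" "level \<beta> k base * level \<beta> k (s x) < 0"
      by (auto simp: separating_def)
    have ne: "aff_refl \<beta> k \<noteq> s"
    proof
      assume "aff_refl \<beta> k = s"
      then consider "\<beta> = \<gamma>" "k = m" | "\<beta> = - \<gamma>" "k = - m"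
        using aff_refl_eqD[OF \<gamma> f(1), of m k] s by auto
      then have "level \<gamma> m base * level \<gamma> m (s x) < 0" using f(3) by cases (auto simp: level_uminus)
      then show False using mult_pos_neg[OF x] by (simp add: lev)
    qed
    then have "\<not> level \<beta> k base * level \<beta> k (s base) < 0"
      using simple_separates_only_itself[OF s(2) f(1)] by blast
    moreover have "level \<beta> k (s base) \<noteq> 0" by (rule W_base_level_nonzero[OF sW f(1)])
    ultimately have "level \<beta> k (s base) * level \<beta> k (s x) < 0"
      using f(3) by (auto simp: mult_less_0_iff)
    moreover obtain \<beta>' k' where "\<beta>' \<in> \<Phi>" "\<And>x. level \<beta> k (s x) = level \<beta>' k' x"
      using W_pull[OF sW f(1)] by metis
    then have "\<exists>\<beta>\<in>\<Phi>. \<exists>k. f \<circ> s = level \<beta> k" using f(2) by (auto simp: fun_eq_iff)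
    moreover have "f \<circ> s \<noteq> level \<gamma> m"
    proof
      assume "f \<circ> s = level \<gamma> m"
      then have "level \<beta> k (s (s y)) = level \<gamma> m (s y)" for y using f(2) by (metis comp_apply)
      then have "level \<beta> k y = level (- \<gamma>) (- m) y" for y by (simp add: inv lev level_uminus)
      then have "\<beta> = - \<gamma>" "k = - m" using level_eqD by blast+
      then show False using ne s aff_refl_uminus by metis
    qed
    ultimately show "f \<circ> s \<in> separating x - {level \<gamma> m}"
      using f(2) by (simp add: separating_def)
  qed
  moreover have "inj_on (\<lambda>f. f \<circ> s) (separating (s x))"
    by (rule inj_onI) (metis comp_assoc comp_id R_invol[OF S_subset_R[OF s(2)]])
  ultimately have "card (separating (s x)) \<le> card (separating x - {level \<gamma> m})"
    using card_inj_on_le finite_separating by blast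
  also have "\<dots> < card (separating x)"
    by (rule card_Diff1_less[OF finite_separating])
      (use x \<gamma> in \<open>auto simp: separating_def mult_less_0_iff\<close>)
  finally show ?thesis .
qed

section \<open>The group generated by the simple reflections\<close>

definition generated :: "('a \<Rightarrow> 'a) set" where
  "generated = {wprod xs | xs. set xs \<subseteq> S}"

lemma generated_id: "id \<in> generated"
  unfolding generated_def by (auto simp flip: wprod_Nil)

lemma generated_comp: "u \<in> generated \<Longrightarrow> v \<in> generated \<Longrightarrow> u \<circ> v \<in> generated"
  unfolding generated_def by clarify (metis wprod_append set_append Un_least)

lemma simple_generated: "s \<in> S \<Longrightarrow> s \<in> generated"
  unfolding generated_def by (auto simp: wprod_Cons wprod_Nil intro!: exI[of _ "[s]"])

lemma wprod_in_W: "set xs \<subseteq> S \<Longrightarrow> wprod xs \<in> W"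
proof (induction xs)
  case (Cons s xs)
  then have "s \<in> W" "wprod xs \<in> W" using R_subset_W S_subset_R by simp_all
  then show ?case unfolding wprod_Cons by (rule W_comp)
qed (simp add: wprod_Nil affW_id)

lemma generated_in_W: "u \<in> generated \<Longrightarrow> u \<in> W"
  unfolding generated_def using wprod_in_W by blast

lemma generated_inv: "u \<in> generated \<Longrightarrow> inv u \<in> generated"
proof -
  have "inv (wprod xs) \<in> generated" if "set xs \<subseteq> S" for xs :: "('a \<Rightarrow> 'a) list"
    using that
  proof (induction xs)
    case (Cons s xs)
    have s: "s \<in> R" using Cons.prems S_subset_R by simp
    have "inv (s \<circ> wprod xs) = inv (wprod xs) \<circ> inv s"
      using Cons.prems W_bij wprod_in_W R_subset_W[OF s] by (intro o_inv_distrib) simp_all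
    moreover have "inv s = s" using R_invol[OF s] by (intro inv_unique_comp)
    moreover have "inv (wprod xs) \<circ> s \<in> generated"
      by (rule generated_comp[OF Cons.IH simple_generated]) (use Cons.prems in simp_all)
    ultimately show ?case by (simp only: wprod_Cons)
  qed (simp add: wprod_Nil inv_id generated_id)
  then show "u \<in> generated \<Longrightarrow> inv u \<in> generated" unfolding generated_def by blast
qed

text \<open>Every other root line meets the given one in at most one point. There are countably many
  root lines, while a line has uncountably many points.\<close>

lemma generic_point:
  assumes \<beta>: "\<beta> \<in> \<Phi>"
  obtains q where "level \<beta> k q = 0"
    "\<And>\<gamma> m. \<gamma> \<in> \<Phi> \<Longrightarrow> level \<gamma> m q = 0 \<Longrightarrow> aff_refl \<gamma> m = aff_refl \<beta> k"
proof -
  obtain z where z: "level \<beta> k z = 0" using level_surj root_nonzero[OF \<beta>] by blast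
  obtain d where d: "d \<noteq> 0" "d \<bullet> \<beta> = 0" using perp_exists by blast
  have q: "level \<beta> k (z + t *\<^sub>R d) = 0" for t
    using z d by (simp add: level_def inner_add_left)
  define B where "B \<gamma> m = {t. aff_refl \<gamma> m \<noteq> aff_refl \<beta> k \<and> level \<gamma> m (z + t *\<^sub>R d) = 0}" for \<gamma> m
  have "countable (B \<gamma> m)" if "\<gamma> \<in> \<Phi>" for \<gamma> m
  proof -
    have "t = t'" if t: "t \<in> B \<gamma> m" "t' \<in> B \<gamma> m" for t t'
    proof -
      have "z + t *\<^sub>R d = z + t' *\<^sub>R d"
        using t q by (intro hyp_inter_unique[OF \<open>\<gamma> \<in> \<Phi>\<close> \<beta>, of m k]) (auto simp: B_def)
      then show ?thesis using d by simp
    qed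
    then have "B \<gamma> m \<subseteq> {SOME t. t \<in> B \<gamma> m}" by (metis singletonI someI subsetI)
    then show ?thesis by (rule countable_subset) simp
  qed
  then have "countable (\<Union>\<gamma>\<in>\<Phi>. \<Union>m. B \<gamma> m)"
    using countable_finite[OF finite_roots] by (intro countable_UN) auto
  then have "(\<Union>\<gamma>\<in>\<Phi>. \<Union>m. B \<gamma> m) \<noteq> UNIV" using uncountable_UNIV_real by metis
  then obtain t where "\<And>\<gamma> m. \<gamma> \<in> \<Phi> \<Longrightarrow> t \<notin> B \<gamma> m" by blast
  then show ?thesis using that[of "z + t *\<^sub>R d"] q by (auto simp: B_def)
qed

text \<open>A generic point of the line is moved into the closed alcove by simple reflections. Its
  image still lies on a root line, hence on a wall; genericity identifies the pulled back wall with
  the given line, so the reflection is conjugate to a simple one.\<close>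

lemma refl_generated:
  assumes \<beta>: "\<beta> \<in> \<Phi>" shows "aff_refl \<beta> k \<in> generated"
proof -
  obtain J where J: "finite J" "J \<subseteq> \<Phi> \<times> UNIV" "A0 \<Phi> \<xi> = {v. \<forall>(\<beta>, k)\<in>J. level \<beta> k v > 0}"
    "\<And>J'. J' \<subset> J \<Longrightarrow> A0 \<Phi> \<xi> \<noteq> {v. \<forall>(\<beta>, k)\<in>J'. level \<beta> k v > 0}"
    using A0_minimal_walls by blast
  have simple: "aff_refl \<gamma> m \<in> S" "\<gamma> \<in> \<Phi>" "level \<gamma> m base > 0" if "(\<gamma>, m) \<in> J" for \<gamma> m
    using minimal_wall_simple[OF J that] that J(2) base_in_A0 J(3) by auto
  \<comment> \<open>As long as some wall inequality fails, reflecting in that wall lowers the number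
    of separating functions.\<close>
  have move: "\<exists>u\<in>generated. \<forall>(\<gamma>, m)\<in>J. level \<gamma> m (u x) \<ge> 0" for x
  proof (induction "card (separating x)" arbitrary: x rule: less_induct)
    case less
    show ?case
    proof (cases "\<forall>(\<gamma>, m)\<in>J. level \<gamma> m x \<ge> 0")
      case True
      then show ?thesis using generated_id by (intro bexI[of _ id]) auto
    next
      case False
      then obtain \<gamma> m where g: "(\<gamma>, m) \<in> J" "level \<gamma> m x < 0" by fastforce
      then have "card (separating (aff_refl \<gamma> m x)) < card (separating x)"
        using separating_simple_less[OF refl] simple by blast
      from less[OF this] obtain u
        where "u \<in> generated" "\<forall>(\<gamma>', m')\<in>J. level \<gamma>' m' (u (aff_refl \<gamma> m x)) \<ge> 0" by blast
      then show ?thesis using generated_comp[of u "aff_refl \<gamma> m"] simple_generated simple g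
        by (intro bexI[of _ "u \<circ> aff_refl \<gamma> m"]) auto
    qed
  qed
  obtain q where q: "level \<beta> k q = 0"
    "\<And>\<gamma> m. \<gamma> \<in> \<Phi> \<Longrightarrow> level \<gamma> m q = 0 \<Longrightarrow> aff_refl \<gamma> m = aff_refl \<beta> k"
    using generic_point[OF \<beta>] by blast
  obtain u where u: "u \<in> generated" "\<forall>(\<gamma>, m)\<in>J. level \<gamma> m (u q) \<ge> 0" using move by blast
  have uW: "u \<in> W" using u generated_in_W by blast
  obtain \<beta>' k' where "\<beta>' \<in> \<Phi>" "level \<beta>' k' (u q) = 0" using W_push[OF uW \<beta>, of k] q by metis
  then have "u q \<notin> A0 \<Phi> \<xi>" using A0_level_nonzero by blast
  then obtain \<gamma> m where g: "(\<gamma>, m) \<in> J" "\<not> level \<gamma> m (u q) > 0" using J(3) by auto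
  then have g0: "level \<gamma> m (u q) = 0" using u by fastforce
  obtain \<gamma>' m' where g': "\<gamma>' \<in> \<Phi>" "\<And>x. level \<gamma> m (u x) = level \<gamma>' m' x"
    "\<And>x. u (aff_refl \<gamma>' m' x) = aff_refl \<gamma> m (u x)"
    using W_pull[OF uW simple(2)[OF g(1)]] by metis
  then have "aff_refl \<gamma>' m' = aff_refl \<beta> k" using q(2) g0 by metis
  then have "aff_refl \<beta> k = inv u \<circ> aff_refl \<gamma> m \<circ> u"
    using g'(3)[symmetric] by (simp add: fun_eq_iff W_inv_simps(1)[OF uW])
  moreover have "inv u \<circ> aff_refl \<gamma> m \<circ> u \<in> generated"
    by (intro generated_comp generated_inv u(1) simple_generated simple(1)[OF g(1)])
  ultimately show ?thesis by simp
qed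

lemma W_generated: "w \<in> W \<Longrightarrow> w \<in> generated"
proof (induction rule: affW.induct)
  case affW_id
  show ?case by (rule generated_id)
next
  case (affW_step \<beta> w k)
  then show ?case using generated_comp refl_generated by blast
qed

end

section \<open>Inversions and length\<close>

context affine_weyl_plane
begin

text \<open>The left inversion set, described geometrically; \<open>inversion_iff_len\<close>
  identifies it with the reflections that shorten \<open>w\<close> from the left.\<close>

definition inversions :: "('a \<Rightarrow> 'a) \<Rightarrow> ('a \<Rightarrow> 'a) set" where
  "inversions w = {aff_refl \<beta> k | \<beta> k. \<beta> \<in> \<Phi> \<and> level \<beta> k base * level \<beta> k (w base) < 0}"

lemma aff_refl_inversions:
  assumes "\<beta> \<in> \<Phi>"
  shows "aff_refl \<beta> k \<in> inversions w \<longleftrightarrow> level \<beta> k base * level \<beta> k (w base) < 0"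
proof
  assume "aff_refl \<beta> k \<in> inversions w"
  then obtain \<gamma> m where g: "\<gamma> \<in> \<Phi>" "aff_refl \<beta> k = aff_refl \<gamma> m" "level \<gamma> m base * level \<gamma> m (w base) < 0"
    by (auto simp: inversions_def)
  then consider "\<gamma> = \<beta>" "m = k" | "\<gamma> = - \<beta>" "m = - k" using aff_refl_eqD[OF assms g(1,2)] by blast
  then show "level \<beta> k base * level \<beta> k (w base) < 0" using g(3) by cases (auto simp: level_uminus)
qed (use assms in \<open>auto simp: inversions_def\<close>)

text \<open>The cocycle rule. A line separates \<open>base\<close> from \<open>u (w base)\<close>
  iff it separates exactly one of the pairs \<open>base\<close>, \<open>u base\<close> and
  \<open>u base\<close>, \<open>u (w base)\<close>; the inverse of \<open>u\<close> carries the
  second pair to \<open>base\<close>, \<open>w base\<close>.\<close>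

lemma inversions_comp:
  assumes "u \<in> W" "w \<in> W" "r \<in> R"
  shows "r \<in> inversions (u \<circ> w) \<longleftrightarrow> (r \<in> inversions u \<longleftrightarrow> inv u \<circ> r \<circ> u \<notin> inversions w)"
proof -
  obtain \<beta> k where r: "r = aff_refl \<beta> k" "\<beta> \<in> \<Phi>" using assms by (auto simp: R_def)
  obtain \<beta>' k' where b: "\<beta>' \<in> \<Phi>" "\<And>x. level \<beta> k (u x) = level \<beta>' k' x"
    "\<And>x. u (aff_refl \<beta>' k' x) = aff_refl \<beta> k (u x)" using W_pull[OF assms(1) r(2)] by metis
  have c: "inv u \<circ> r \<circ> u = aff_refl \<beta>' k'"
    unfolding r using b(3)[symmetric] by (simp add: fun_eq_iff W_inv_simps(1)[OF assms(1)])
  have "level \<beta> k base \<noteq> 0" "level \<beta> k (u base) \<noteq> 0" "level \<beta> k (u (w base)) \<noteq> 0"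
    using A0_level_nonzero[OF base_in_A0 r(2)] W_base_level_nonzero[OF assms(1) r(2)]
      W_base_level_nonzero[OF W_comp[OF assms(1,2)] r(2)] by auto
  then show ?thesis
    unfolding c unfolding r(1) aff_refl_inversions[OF r(2)] aff_refl_inversions[OF b(1)] b(2)[symmetric]
    by (auto simp: mult_less_0_iff)
qed

lemma refl_in_inversions_self: "r \<in> R \<Longrightarrow> r \<in> inversions r"
proof -
  assume "r \<in> R"
  then obtain \<beta> k where r: "r = aff_refl \<beta> k" "\<beta> \<in> \<Phi>" by (auto simp: R_def)
  then show ?thesis using A0_level_nonzero[OF base_in_A0 r(2), of k]
    by (simp add: aff_refl_inversions level_self_aff_refl root_nonzero zero_less_mult_iff)
       linarith
qed

lemma inversions_simple:
  assumes "s \<in> S" shows "inversions s = {s}"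
  using simple_separates_only_itself[OF assms] refl_in_inversions_self[OF S_subset_R[OF assms]]
  by (auto simp: inversions_def)

lemma inv_refl: "r \<in> R \<Longrightarrow> inv r = r"
  by (intro inv_unique_comp R_invol)

lemma conj_refl: "s \<in> R \<Longrightarrow> r \<in> R \<Longrightarrow> s \<circ> r \<circ> s \<in> R"
  using R_conj[of s r] inv_refl R_subset_W by metis

lemma refl_cancel: "r \<in> R \<Longrightarrow> r \<circ> (r \<circ> w) = w"
  using R_invol by (simp flip: comp_assoc)

lemma refl_cancel_right: "r \<in> R \<Longrightarrow> w \<circ> r \<circ> r = w"
  using R_invol by (simp add: comp_assoc)

section \<open>Words, length and the exchange property\<close>

lemma word_exists: "w \<in> W \<Longrightarrow> \<exists>xs. length xs = \<ll> w \<and> set xs \<subseteq> S \<and> w = wprod xs"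
  unfolding len_def wprod_def[symmetric] using W_generated[of w]
  by (intro LeastI_ex[of "\<lambda>n. \<exists>xs. length xs = n \<and> set xs \<subseteq> S \<and> w = wprod xs"])
    (auto simp: generated_def)

lemma len_le: "set xs \<subseteq> S \<Longrightarrow> \<ll> (wprod xs) \<le> length xs"
  unfolding len_def wprod_def[symmetric] by (intro Least_le) auto

text \<open>The strong exchange property. If the reflection is the first letter, that letter
  cancels; otherwise conjugation moves it past the letter, and by the cocycle rule it is an
  inversion of the remaining word.\<close>

lemma inversion_shortens_word:
  assumes "set xs \<subseteq> S" "r \<in> R" "r \<in> inversions (wprod xs)"
  shows "\<exists>ys. set ys \<subseteq> S \<and> length ys < length xs \<and> r \<circ> wprod xs = wprod ys"
  using assms
proof (induction xs arbitrary: r)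
  case Nil
  then have False by (auto simp: inversions_def wprod_Nil mult_less_0_iff)
  then show ?case ..
next
  case (Cons s xs)
  define u where "u = wprod xs"
  have s: "s \<in> S" "s \<in> R" "s \<in> W" and xs: "set xs \<subseteq> S"
    using Cons.prems(1) S_subset_R R_subset_W by auto
  have uW: "u \<in> W" unfolding u_def by (rule wprod_in_W[OF xs])
  have eq: "wprod (s # xs) = s \<circ> u" unfolding u_def by (rule wprod_Cons)
  show ?case
  proof (cases "r = s")
    case True
    then have "r \<circ> wprod (s # xs) = wprod xs"
      unfolding eq using refl_cancel[OF s(2)] u_def by simp
    then show ?thesis using xs by (intro exI[of _ xs]) auto
  next
    case False
    have "r \<in> inversions (s \<circ> u)" using Cons.prems(3) unfolding eq .
    then have "s \<circ> r \<circ> s \<in> inversions u"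
      using inversions_comp[OF s(3) uW Cons.prems(2)] inversions_simple[OF s(1)] inv_refl[OF s(2)] False
      by simp
    then obtain ys where ys: "set ys \<subseteq> S" "length ys < length xs" "(s \<circ> r \<circ> s) \<circ> u = wprod ys"
      using Cons.IH[OF xs conj_refl[OF s(2) Cons.prems(2)]] unfolding u_def by blast
    have "r \<circ> (s \<circ> u) = s \<circ> ((s \<circ> r \<circ> s) \<circ> u)"
      using R_invol[OF s(2)] by (simp add: fun_eq_iff)
    also have "\<dots> = wprod (s # ys)" unfolding ys(3) wprod_Cons ..
    finally have "r \<circ> wprod (s # xs) = wprod (s # ys)" unfolding eq .
    moreover have "set (s # ys) \<subseteq> S" "length (s # ys) < length (s # xs)" using ys s by simp_all
    ultimately show ?thesis by blast
  qed
qed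

lemma inversion_iff_len:
  assumes "w \<in> W" "r \<in> R"
  shows "r \<in> inversions w \<longleftrightarrow> \<ll> (r \<circ> w) < \<ll> w"
    and "r \<notin> inversions w \<longleftrightarrow> \<ll> w < \<ll> (r \<circ> w)"
proof -
  have *: "\<ll> (r \<circ> w) < \<ll> w" if "r \<in> inversions w" "w \<in> W" for w
    using word_exists[OF that(2)] inversion_shortens_word[OF _ assms(2)] that(1) len_le
    by (metis dual_order.strict_trans2)
  have rW: "r \<in> W" using assms R_subset_W by blast
  \<comment> \<open>By the cocycle rule \<open>r\<close> is an inversion of exactly one of
    \<open>w\<close> and \<open>r \<circ> w\<close>, so the first direction applies to
    \<open>r \<circ> w\<close>.\<close>
  have "\<ll> w < \<ll> (r \<circ> w)" if "r \<notin> inversions w"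
  proof -
    have "inv r \<circ> r \<circ> r = r" using inv_refl R_invol assms by simp
    then have "r \<in> inversions (r \<circ> w)"
      using inversions_comp[OF rW assms(1,2)] that refl_in_inversions_self assms by simp
    from *[OF this W_comp[OF rW assms(1)]] show ?thesis unfolding refl_cancel[OF assms(2)] .
  qed
  then show "r \<in> inversions w \<longleftrightarrow> \<ll> (r \<circ> w) < \<ll> w" "r \<notin> inversions w \<longleftrightarrow> \<ll> w < \<ll> (r \<circ> w)"
    using *[OF _ assms(1)] by fastforce+
qed

lemma len_refl_neq: "w \<in> W \<Longrightarrow> r \<in> R \<Longrightarrow> \<ll> (r \<circ> w) \<noteq> \<ll> w"
  using inversion_iff_len by (metis less_irrefl)

lemma len_simple_le:
  assumes "w \<in> W" "s \<in> S" shows "\<ll> (s \<circ> w) \<le> Suc (\<ll> w)" "\<ll> (w \<circ> s) \<le> Suc (\<ll> w)"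
proof -
  obtain xs where xs: "length xs = \<ll> w" "set xs \<subseteq> S" "w = wprod xs"
    using word_exists[OF assms(1)] by blast
  have "\<ll> (wprod (s # xs)) \<le> length (s # xs)" using xs assms by (intro len_le) auto
  then show "\<ll> (s \<circ> w) \<le> Suc (\<ll> w)" using xs(1) unfolding wprod_Cons xs(3)[symmetric] by simp
  have "\<ll> (wprod (xs @ [s])) \<le> length (xs @ [s])" using xs assms by (intro len_le) auto
  moreover have "wprod [s] = s" by (simp add: wprod_Cons wprod_Nil)
  ultimately show "\<ll> (w \<circ> s) \<le> Suc (\<ll> w)"
    using xs(1) unfolding wprod_append xs(3)[symmetric] by simp
qed

lemma len_simple_cases:
  assumes "w \<in> W" "s \<in> S"
  shows "\<ll> (s \<circ> w) = Suc (\<ll> w) \<or> \<ll> w = Suc (\<ll> (s \<circ> w))"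
  using len_simple_le(1)[OF assms] len_simple_le(1)[of "s \<circ> w" s] len_refl_neq[of w s]
    refl_cancel[of s w] assms S_subset_R R_subset_W W_comp
  by (metis le_SucE le_antisym)

lemma conj_eq_right: "w \<in> W \<Longrightarrow> w \<circ> s \<circ> inv w \<circ> w = w \<circ> s"
  by (simp add: fun_eq_iff W_inv_simps)

text \<open>Right multiplication by \<open>s\<close> is left multiplication by a conjugate
  reflection, so it cannot preserve the length.\<close>

lemma len_simple_right_cases:
  assumes "w \<in> W" "s \<in> S"
  shows "\<ll> (w \<circ> s) = Suc (\<ll> w) \<or> \<ll> w = Suc (\<ll> (w \<circ> s))"
proof -
  have s: "s \<in> R" "s \<in> W" using assms S_subset_R R_subset_W by auto
  have "\<ll> (w \<circ> s) \<noteq> \<ll> w"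
    using len_refl_neq[OF assms(1) R_conj[OF assms(1) s(1)]] conj_eq_right[OF assms(1)] by simp
  moreover have "\<ll> (w \<circ> s) \<le> Suc (\<ll> w)" "\<ll> w \<le> Suc (\<ll> (w \<circ> s))"
    using len_simple_le(2)[OF assms] len_simple_le(2)[OF W_comp[OF assms(1) s(2)] assms(2)]
      unfolding refl_cancel_right[OF s(1)] by simp_all
  ultimately show ?thesis by linarith
qed

text \<open>The conjugate of \<open>r\<close> by \<open>s\<close> relates the two shifted elements.
  By the cocycle rule it could become an inversion only if it were \<open>s\<close>, the sole
  inversion of \<open>s\<close>.\<close>

lemma refl_up_simple_left:
  assumes "x \<in> W" "s \<in> S" "r \<in> R" "r \<noteq> s" "\<ll> x < \<ll> (r \<circ> x)"
  shows "\<ll> (s \<circ> x) < \<ll> (s \<circ> (r \<circ> x))"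
proof -
  have s: "s \<in> R" "s \<in> W" using assms S_subset_R R_subset_W by auto
  define q where "q = s \<circ> r \<circ> s"
  have q: "q \<in> R" unfolding q_def by (rule conj_refl[OF s(1) assms(3)])
  have sqs: "s \<circ> q \<circ> s = r" unfolding q_def using R_invol[OF s(1)] by (simp add: fun_eq_iff)
  have "q \<noteq> s"
  proof
    assume "q = s"
    then have "r = s" using sqs R_invol[OF s(1)] by simp
    then show False using assms by simp
  qed
  moreover have "r \<notin> inversions x" using inversion_iff_len(2) assms by blast
  ultimately have "q \<notin> inversions (s \<circ> x)"
    using inversions_comp[OF s(2) assms(1) q] inversions_simple[OF assms(2)] inv_refl[OF s(1)] sqs by simp
  then have "\<ll> (s \<circ> x) < \<ll> (q \<circ> (s \<circ> x))"
    using inversion_iff_len(2)[OF W_comp[OF s(2) assms(1)] q] by blast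
  moreover have "q \<circ> (s \<circ> x) = s \<circ> (r \<circ> x)" unfolding q_def using R_invol[OF s(1)] by (simp add: fun_eq_iff)
  ultimately show ?thesis by simp
qed

text \<open>The inversions of \<open>x\<close> and \<open>x \<circ> s\<close> differ only in the
  conjugate of \<open>s\<close> by \<open>x\<close>, and the assumption on
  \<open>r \<circ> x\<close> says that \<open>r\<close> is not this conjugate.\<close>

lemma refl_up_simple_right:
  assumes "x \<in> W" "s \<in> S" "r \<in> R" "r \<circ> x \<noteq> x \<circ> s" "\<ll> x < \<ll> (r \<circ> x)"
  shows "\<ll> (x \<circ> s) < \<ll> (r \<circ> x \<circ> s)"
proof -
  have s: "s \<in> R" "s \<in> W" using assms S_subset_R R_subset_W by auto
  have "inv x \<circ> r \<circ> x \<noteq> s"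
    using assms(4) by (metis W_inv_simps(2)[OF assms(1)] comp_apply ext)
  moreover have "r \<notin> inversions x" using inversion_iff_len(2) assms by blast
  ultimately have "r \<notin> inversions (x \<circ> s)"
    using inversions_comp[OF assms(1) s(2) assms(3)] inversions_simple[OF assms(2)] by simp
  then show ?thesis
    using inversion_iff_len(2)[OF W_comp[OF assms(1) s(2)] assms(3)] by (simp add: comp_assoc)
qed

lemma left_descent_exists:
  assumes "w \<in> W" "\<ll> w > 0" obtains s where "s \<in> S" "\<ll> (s \<circ> w) < \<ll> w"
proof -
  obtain xs where xs: "length xs = \<ll> w" "set xs \<subseteq> S" "w = wprod xs"
    using word_exists[OF assms(1)] by blast
  then obtain s ys where ys: "xs = s # ys" using assms by (cases xs) auto
  have s: "s \<in> S" using xs ys by auto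
  have "s \<circ> w = wprod ys"
    unfolding xs(3) ys wprod_Cons by (rule refl_cancel[OF S_subset_R[OF s]])
  moreover have "\<ll> (wprod ys) \<le> length ys" using xs ys by (intro len_le) auto
  ultimately show ?thesis using that[OF s] xs ys by simp
qed

end

section \<open>Bruhat order and chains of parallel reflections\<close>

context affine_weyl_plane
begin

abbreviation bruhat_step :: "('a \<Rightarrow> 'a) \<Rightarrow> ('a \<Rightarrow> 'a) \<Rightarrow> bool" where
  "bruhat_step \<equiv> (\<lambda>x y. \<exists>t\<in>refls \<Phi> \<xi>. y = t \<circ> x \<and> \<ll> x < \<ll> y)"

lemma refls_subset_R: "t \<in> refls \<Phi> \<xi> \<Longrightarrow> t \<in> R"
  unfolding refls_def using R_conj S_subset_R by blast

lemma simple_in_refls: "s \<in> S \<Longrightarrow> s \<in> refls \<Phi> \<xi>"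
proof -
  assume "s \<in> S"
  moreover have "s = id \<circ> s \<circ> inv id" by simp
  ultimately show ?thesis unfolding refls_def using affW_id by blast
qed

lemma refls_conj:
  assumes "s \<in> S" "t \<in> refls \<Phi> \<xi>" shows "s \<circ> t \<circ> s \<in> refls \<Phi> \<xi>"
proof -
  obtain u s' where t: "t = u \<circ> s' \<circ> inv u" "u \<in> W" "s' \<in> S" using assms(2) by (auto simp: refls_def)
  have s: "s \<in> R" "s \<in> W" using assms S_subset_R R_subset_W by auto
  have "inv (s \<circ> u) = inv u \<circ> s"
    using o_inv_distrib[of s u] W_bij s t(2) inv_refl[OF s(1)] by simp
  then have "s \<circ> t \<circ> s = (s \<circ> u) \<circ> s' \<circ> inv (s \<circ> u)" unfolding t(1) by (simp only: comp_assoc)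
  then show ?thesis unfolding refls_def using W_comp[OF s(2) t(2)] t(3) by blast
qed

text \<open>The shorter of \<open>x\<close> and \<open>s \<circ> x\<close>; passing to it is monotone for the Bruhat order, which is
  the lifting property in a form without case distinctions.\<close>
definition lower :: "('a \<Rightarrow> 'a) \<Rightarrow> ('a \<Rightarrow> 'a) \<Rightarrow> 'a \<Rightarrow> 'a" where
  "lower s x = (if \<ll> (s \<circ> x) < \<ll> x then s \<circ> x else x)"

text \<open>If \<open>t = s\<close>, both sides become \<open>x\<close>. Otherwise the step survives
  multiplication by \<open>s\<close>, through the conjugate of \<open>t\<close>; in the mixed cases
  it is joined to the step between \<open>x\<close> and \<open>s \<circ> x\<close>.\<close>

lemma lower_step:
  assumes "x \<in> W" "s \<in> S" "bruhat_step x y"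
  shows "bruhat_step\<^sup>*\<^sup>* (lower s x) (lower s y)"
proof -
  obtain t where t: "t \<in> refls \<Phi> \<xi>" "y = t \<circ> x" "\<ll> x < \<ll> y" using assms by blast
  have s: "s \<in> R" "s \<in> W" using assms S_subset_R R_subset_W by auto
  have tR: "t \<in> R" using refls_subset_R t by blast
  show ?thesis
  proof (cases "t = s")
    case True
    then have "s \<circ> y = x" using t refl_cancel[OF s(1)] by simp
    then have "lower s y = x" "lower s x = x" using t True by (auto simp: lower_def)
    then show ?thesis by simp
  next
    case False
    then have up: "\<ll> (s \<circ> x) < \<ll> (s \<circ> y)"
      using refl_up_simple_left[OF assms(1,2) tR False] t by simp
    have step: "bruhat_step x y" using t by blast
    have "s \<circ> y = (s \<circ> t \<circ> s) \<circ> (s \<circ> x)" using t R_invol[OF s(1)] by (simp add: fun_eq_iff)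
    then have sstep: "bruhat_step (s \<circ> x) (s \<circ> y)" using refls_conj[OF assms(2) t(1)] up by blast
    have sx: "bruhat_step (s \<circ> x) x" if "\<ll> (s \<circ> x) < \<ll> x"
      using that refl_cancel[OF s(1), of x] simple_in_refls[OF assms(2)] by metis
    have xs: "bruhat_step x (s \<circ> x)" if "\<not> \<ll> (s \<circ> x) < \<ll> x"
      using that len_refl_neq[OF assms(1) s(1)] simple_in_refls[OF assms(2)] by (metis linorder_neqE_nat)
    show ?thesis
    proof (cases "\<ll> (s \<circ> x) < \<ll> x"; cases "\<ll> (s \<circ> y) < \<ll> y")
      assume c: "\<ll> (s \<circ> x) < \<ll> x" "\<not> \<ll> (s \<circ> y) < \<ll> y"
      have "bruhat_step\<^sup>*\<^sup>* (s \<circ> x) y"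
        by (rule converse_rtranclp_into_rtranclp[of bruhat_step, OF sx[OF c(1)] r_into_rtranclp[of bruhat_step, OF step]])
      then show ?thesis using c by (simp add: lower_def)
    next
      assume c: "\<not> \<ll> (s \<circ> x) < \<ll> x" "\<ll> (s \<circ> y) < \<ll> y"
      have "bruhat_step\<^sup>*\<^sup>* x (s \<circ> y)"
        by (rule converse_rtranclp_into_rtranclp[of bruhat_step, OF xs[OF c(1)] r_into_rtranclp[of bruhat_step, OF sstep]])
      then show ?thesis using c by (simp add: lower_def)
    next
      assume c: "\<ll> (s \<circ> x) < \<ll> x" "\<ll> (s \<circ> y) < \<ll> y"
      show ?thesis using r_into_rtranclp[of bruhat_step, OF sstep] c by (simp add: lower_def)
    next
      assume c: "\<not> \<ll> (s \<circ> x) < \<ll> x" "\<not> \<ll> (s \<circ> y) < \<ll> y"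
      show ?thesis using r_into_rtranclp[of bruhat_step, OF step] c by (simp add: lower_def)
    qed
  qed
qed

lemma bruhat_lower:
  assumes "bruhat_le \<Phi> \<xi> x y" "s \<in> S"
  shows "bruhat_le \<Phi> \<xi> (lower s x) (lower s y)"
proof -
  have x: "x \<in> W" and y: "y \<in> W" and xy: "bruhat_step\<^sup>*\<^sup>* x y" using assms by (auto simp: bruhat_le_def)
  have low: "lower s z \<in> W" if "z \<in> W" for z
    using that W_comp R_subset_W S_subset_R assms(2) by (auto simp: lower_def)
  have "y \<in> W \<and> bruhat_step\<^sup>*\<^sup>* (lower s x) (lower s y)" using xy
  proof (induction rule: rtranclp_induct)
    case (step y z)
    then show ?case using lower_step[OF _ assms(2), of y z] R_subset_W refls_subset_R W_comp
      by (smt (verit) rtranclp_trans)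
  qed (use x in simp)
  then show ?thesis unfolding bruhat_le_def using low x by blast
qed

lemma bruhat_len:
  assumes "bruhat_le \<Phi> \<xi> x y" shows "x = y \<or> \<ll> x < \<ll> y"
proof -
  have "bruhat_step\<^sup>*\<^sup>* x y" using assms by (simp add: bruhat_le_def)
  then show ?thesis by (induction rule: rtranclp_induct) auto
qed

section \<open>Chains of parallel reflections\<close>

lemma refl_R: "\<alpha> \<in> \<Phi> \<Longrightarrow> aff_refl \<alpha> k \<in> R"
  by (auto simp: R_def)

lemma rchain_W: "\<alpha> \<in> \<Phi> \<Longrightarrow> rchain \<alpha> c t \<in> W"
proof (induction t)
  case (Suc t)
  then show ?case unfolding rchain.simps by (intro affW_step) auto
qed (simp add: affW_id)

text \<open>If \<open>u\<close> matches the lines with index \<open>c\<close> and \<open>c'\<close>,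
  it matches all later ones too, because shifting the constant commutes with the action.\<close>

lemma rchain_conj:
  assumes "u \<in> W" "\<alpha> \<in> \<Phi>" "\<And>x. level \<alpha>' c' (u x) = level \<alpha> c x"
  shows "rchain \<alpha>' c' t \<circ> u = u \<circ> rchain \<alpha> c t"
proof (induction t)
  case (Suc t)
  have "level \<alpha>' (c' + int (Suc t)) (u x) = level \<alpha> (c + int (Suc t)) x" for x
    using assms(3)[of x] by (simp add: level_def)
  from W_push_aff_refl[OF assms(1,2) this] Suc show ?case by (simp add: fun_eq_iff)
qed simp

text \<open>The first reflection sends the line of \<alpha> at c + 1 + t to the one at c + 1 - t,
  which for the opposite root has constant -c - 1 + t. The remaining reflections thus become a chain
  in the opposite direction.\<close>

lemma rchain_uminus:
  assumes "\<alpha> \<in> \<Phi>"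
  shows "rchain (- \<alpha>) (- c - 1) t = aff_refl \<alpha> (c + 1) \<circ> rchain \<alpha> c (Suc t)"
proof (induction t)
  case 0
  show ?case by (rule ext) (simp add: aff_refl_invol root_nonzero[OF assms])
next
  case (Suc t)
  define s where "s = aff_refl \<alpha> (c + 1)"
  have s: "s \<in> R" "s \<in> W" using refl_R[OF assms] R_subset_W by (auto simp: s_def)
  have "level (- \<alpha>) (- c - 1 + int (Suc t)) (s x) = level \<alpha> (c + int (Suc (Suc t))) x" for x
    using level_self_aff_refl[OF root_nonzero[OF assms], of "c + 1" x] by (simp add: level_def s_def)
  then have *: "s (aff_refl \<alpha> (c + int (Suc (Suc t))) x) = aff_refl (- \<alpha>) (- c - 1 + int (Suc t)) (s x)" for x
    by (rule W_push_aff_refl[OF s(2) assms])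
  have "rchain (- \<alpha>) (- c - 1) (Suc t) = aff_refl (- \<alpha>) (- c - 1 + int (Suc t)) \<circ> (s \<circ> rchain \<alpha> c (Suc t))"
    using Suc unfolding s_def by (simp only: rchain.simps)
  also have "\<dots> = s \<circ> (aff_refl \<alpha> (c + int (Suc (Suc t))) \<circ> rchain \<alpha> c (Suc t))"
    using * by (simp only: fun_eq_iff comp_apply) simp
  finally show ?case unfolding s_def by (simp only: rchain.simps)
qed

text \<open>Stated for the induction: \<open>s\<close> is fixed, the other data vary, n = 0 is
  allowed, and the strip condition concerns the single point \<open>w base\<close>.\<close>

lemma rchain_not_above:
  assumes "w \<in> W" "s \<in> S" "\<ll> (w \<circ> s) < \<ll> w" "\<alpha> \<in> \<Phi>"
    and "of_int c < w base \<bullet> \<alpha>" "w base \<bullet> \<alpha> < of_int c + 1"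
    and "\<And>t. t < n \<Longrightarrow> \<ll> (rchain \<alpha> c (Suc t) \<circ> w \<circ> s) = Suc (\<ll> (rchain \<alpha> c t \<circ> w \<circ> s))"
    and "\<And>t. t < n \<Longrightarrow> rchain \<alpha> c (Suc t) \<circ> w \<circ> s \<noteq> rchain \<alpha> c t \<circ> w"
  shows "\<not> bruhat_le \<Phi> \<xi> w (rchain \<alpha> c n \<circ> w \<circ> s)"
  using assms
proof (induction "\<ll> (rchain \<alpha> c n \<circ> w \<circ> s)" arbitrary: w \<alpha> c n rule: less_induct)
  case less
  note w = less.prems(1) and sS = less.prems(2) and ws = less.prems(3) and \<alpha> = less.prems(4)
    and strip = less.prems(5,6) and up = less.prems(7) and ne = less.prems(8)
  have s: "s \<in> R" "s \<in> W" using sS S_subset_R R_subset_W by auto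
  define x where "x t = rchain \<alpha> c t \<circ> w \<circ> s" for t
  define r where "r t = aff_refl \<alpha> (c + int t)" for t
  have xW: "x t \<in> W" for t unfolding x_def using W_comp rchain_W[OF \<alpha>] w s by blast
  have rR: "r t \<in> R" for t unfolding r_def by (rule refl_R[OF \<alpha>])
  have xSuc: "x (Suc t) = r (Suc t) \<circ> x t" for t unfolding x_def r_def rchain.simps comp_assoc ..
  have x0: "x 0 = w \<circ> s" by (simp add: x_def)
  have x0s: "x 0 \<circ> s = w" unfolding x0 by (rule refl_cancel_right[OF s(1)])
  have xup: "\<ll> (x (Suc t)) = Suc (\<ll> (x t))" if "t < n" for t using up[OF that] by (simp only: x_def)
  have lw: "\<ll> w = Suc (\<ll> (x 0))"
    using len_simple_right_cases[OF w sS] ws unfolding x0 by linarith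
  show ?case
  proof
    assume "bruhat_le \<Phi> \<xi> w (rchain \<alpha> c n \<circ> w \<circ> s)"
    then have le: "bruhat_le \<Phi> \<xi> w (x n)" by (simp only: x_def)
    \<comment> \<open>Since \<open>w\<close> is longer than \<open>x 0\<close>, it cannot lie below
      it; this disposes of the empty chain.\<close>
    have "x n \<noteq> x 0" using bruhat_len[OF le] lw by auto
    then have n: "n > 0" by (cases n) auto
    then obtain n' where n': "n = Suc n'" by (cases n) auto
    have "\<ll> (x n) > 0" using xup[of n'] n' by simp
    then obtain d where d: "d \<in> S" "\<ll> (d \<circ> x n) < \<ll> (x n)" using left_descent_exists[OF xW] by blast
    have dR: "d \<in> R" "d \<in> W" using d S_subset_R R_subset_W by auto
    have low: "bruhat_le \<Phi> \<xi> (lower d w) (d \<circ> x n)"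
      using bruhat_lower[OF le d(1)] d(2) by (simp add: lower_def)
    \<comment> \<open>For any other reflection, left multiplication by \<open>d\<close> keeps the
      step strictly increasing, and a length jump of exactly one leaves no room for \<open>d\<close>
      to turn into a descent.\<close>
    have cross: "r (Suc t) = d" if "t < n" "\<not> \<ll> (d \<circ> x t) < \<ll> (x t)" "\<ll> (d \<circ> x (Suc t)) < \<ll> (x (Suc t))" for t
    proof (rule ccontr)
      assume "r (Suc t) \<noteq> d"
      then have "\<ll> (d \<circ> x t) < \<ll> (d \<circ> x (Suc t))"
        using refl_up_simple_left[OF xW d(1) rR, of "Suc t" t] xup[OF that(1)] unfolding xSuc by simp
      then show False using that xup[OF that(1)] by linarith
    qed
    show False
    proof (cases "\<forall>t\<le>n. \<ll> (d \<circ> x t) < \<ll> (x t)")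
      case True
      then have all: "\<ll> (x t) = Suc (\<ll> (d \<circ> x t))" if "t \<le> n" for t
        using that len_simple_cases[OF xW d(1), of t] by force
      \<comment> \<open>Here \<open>w\<close> is \<open>x 0 \<circ> s\<close>, so
        \<open>d \<circ> w\<close> is at most one longer than \<open>d \<circ> x 0\<close>, hence no
        longer than \<open>x 0\<close> and shorter than \<open>w\<close>.\<close>
      have dw: "\<ll> w = Suc (\<ll> (d \<circ> w))"
      proof -
        have "\<ll> (d \<circ> w) \<le> Suc (\<ll> (d \<circ> x 0))"
          using len_simple_le(2)[OF W_comp[OF dR(2) xW] sS, of 0] x0s by (simp add: comp_assoc)
        then show ?thesis using all[of 0] lw len_simple_cases[OF w d(1)] by linarith
      qed
      obtain \<alpha>' c' where a: "\<alpha>' \<in> \<Phi>" "\<And>x. level \<alpha>' c' (d x) = level \<alpha> c x"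
        using W_push[OF dR(2) \<alpha>, of c] by blast
      have rc: "rchain \<alpha>' c' t \<circ> d = d \<circ> rchain \<alpha> c t" for t
        by (rule rchain_conj[OF dR(2) \<alpha> a(2)])
      have y: "rchain \<alpha>' c' t \<circ> (d \<circ> w) = d \<circ> (rchain \<alpha> c t \<circ> w)" for t
        using rc[of t] by (metis comp_assoc)
      have x': "rchain \<alpha>' c' t \<circ> (d \<circ> w) \<circ> s = d \<circ> x t" for t
        using y[of t] unfolding x_def by (metis comp_assoc)
      have "\<not> bruhat_le \<Phi> \<xi> (d \<circ> w) (rchain \<alpha>' c' n \<circ> (d \<circ> w) \<circ> s)"
      proof (rule less.hyps)
        show "\<ll> (rchain \<alpha>' c' n \<circ> (d \<circ> w) \<circ> s) < \<ll> (rchain \<alpha> c n \<circ> w \<circ> s)"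
          using d(2) unfolding x' x_def .
        show "d \<circ> w \<in> W" by (rule W_comp[OF dR(2) w])
        show "s \<in> S" by (rule sS)
        have "d \<circ> w \<circ> s = d \<circ> x 0" unfolding x0 comp_assoc ..
        then show "\<ll> (d \<circ> w \<circ> s) < \<ll> (d \<circ> w)" using all[of 0] dw lw by simp
        show "\<alpha>' \<in> \<Phi>" by (rule a)
        show "of_int c' < (d \<circ> w) base \<bullet> \<alpha>'" "(d \<circ> w) base \<bullet> \<alpha>' < of_int c' + 1"
          using a(2)[of "w base"] strip by (simp_all add: level_def)
        fix t assume t: "t < n"
        show "\<ll> (rchain \<alpha>' c' (Suc t) \<circ> (d \<circ> w) \<circ> s) = Suc (\<ll> (rchain \<alpha>' c' t \<circ> (d \<circ> w) \<circ> s))"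
          unfolding x' using xup[OF t] all[of t] all[of "Suc t"] t by simp
        show "rchain \<alpha>' c' (Suc t) \<circ> (d \<circ> w) \<circ> s \<noteq> rchain \<alpha>' c' t \<circ> (d \<circ> w)"
          unfolding x' unfolding y using ne[OF t] refl_cancel[OF dR(1)] unfolding x_def by metis
      qed
      then show False using low dw unfolding x' by (simp add: lower_def)
    next
      case False
      \<comment> \<open>The last index at which \<open>d\<close> is not a left descent; the next
        reflection of the chain must then be \<open>d\<close>.\<close>
      define t0 where "t0 = Max {t. t \<le> n \<and> \<not> \<ll> (d \<circ> x t) < \<ll> (x t)}"
      have fin: "finite {t. t \<le> n \<and> \<not> \<ll> (d \<circ> x t) < \<ll> (x t)}" by simp
      have "t0 \<in> {t. t \<le> n \<and> \<not> \<ll> (d \<circ> x t) < \<ll> (x t)}"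
        unfolding t0_def using False by (intro Max_in[OF fin]) auto
      then have t0: "t0 \<le> n" "\<not> \<ll> (d \<circ> x t0) < \<ll> (x t0)" by auto
      have after: "\<ll> (d \<circ> x t) < \<ll> (x t)" if "t0 < t" "t \<le> n" for t
        using Max_ge[OF fin, of t] that unfolding t0_def[symmetric] by force
      have "t0 \<noteq> n" using t0 d(2) by auto
      then have t0n: "t0 < n" using t0 by simp
      have rd: "r (Suc t0) = d" using cross[OF t0n t0(2) after[of "Suc t0"]] t0n by simp
      have "t0 = 0"
      proof (rule ccontr)
        assume "t0 \<noteq> 0"
        \<comment> \<open>Otherwise \<open>d\<close>, the reflection in the next line, would carry
          \<open>base\<close> across the line at c + t0 as well, although a simple reflection
          crosses only its own wall.\<close>
        have "base \<bullet> \<alpha> > of_int c + of_int (int t0)"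
        proof (rule ccontr)
          assume neg: "\<not> ?thesis"
          have "level \<alpha> (c + int t0) base \<noteq> 0" by (rule A0_level_nonzero[OF base_in_A0 \<alpha>])
          then have b: "level \<alpha> (c + int t0) base < 0" using neg by (simp add: level_def)
          moreover have "level \<alpha> (c + int (Suc t0)) (d base) = - level \<alpha> (c + int (Suc t0)) base"
            unfolding rd[symmetric] r_def by (rule level_self_aff_refl[OF root_nonzero[OF \<alpha>]])
          ultimately have "level \<alpha> (c + int t0) (d base) > 0" by (simp add: level_def)
          then have "level \<alpha> (c + int t0) base * level \<alpha> (c + int t0) (d base) < 0"
            using b by (simp add: mult_neg_pos)
          then have "aff_refl \<alpha> (c + int t0) = aff_refl \<alpha> (c + int (Suc t0))"
            using simple_separates_only_itself[OF d(1) \<alpha>] rd unfolding r_def by simp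
          moreover have "\<alpha> \<noteq> - \<alpha>"
            using root_nonzero[OF \<alpha>] by (metis inner_eq_zero_iff inner_minus_right equal_neg_zero)
          ultimately show False using aff_refl_eqD[OF \<alpha> \<alpha>, of "c + int t0"] by fastforce
        qed
        then have base1: "level \<alpha> (c + int 1) base > 0" using \<open>t0 \<noteq> 0\<close> by (simp add: level_def)
        \<comment> \<open>Now \<open>base\<close> is above the first line, and so is
          \<open>x 0 base\<close> because the first step goes up, whereas \<open>w base\<close> is
          below. The first line therefore separates \<open>w\<close> from
          \<open>w \<circ> s\<close>, which makes the reflected element equal to \<open>w\<close>,
          the excluded case.\<close>
        have "r 1 \<notin> inversions (x 0)"
          using inversion_iff_len(2)[OF xW rR, of 1 0] xup[OF n] xSuc[of 0] by simp
        moreover have "level \<alpha> (c + int 1) (x 0 base) \<noteq> 0" by (rule W_base_level_nonzero[OF xW \<alpha>])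
        ultimately have "level \<alpha> (c + int 1) (x 0 base) > 0"
          unfolding r_def aff_refl_inversions[OF \<alpha>] using base1 by (simp add: mult_less_0_iff)
        moreover have "level \<alpha> (c + int 1) (w base) < 0" using strip by (simp add: level_def)
        ultimately have "r 1 \<in> inversions w" "r 1 \<notin> inversions (x 0)"
          unfolding r_def aff_refl_inversions[OF \<alpha>] using base1 by (auto simp: mult_less_0_iff)
        then have "inv w \<circ> r 1 \<circ> w = s"
          using inversions_comp[OF w s(2) rR, of 1] inversions_simple[OF sS] unfolding x0 by auto
        then have "r 1 \<circ> w = w \<circ> s" using W_inv_simps(2)[OF w] by (metis comp_apply ext)
        then have "r 1 \<circ> w \<circ> s = w" using refl_cancel_right[OF s(1)] by simp
        then show False using ne[OF n] by (simp add: r_def)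
      qed
      then have d1: "d = aff_refl \<alpha> (c + 1)" using rd by (simp add: r_def)
      have dx0: "d \<circ> x 0 = x 1" using xSuc[of 0] rd \<open>t0 = 0\<close> by simp
      have all: "\<ll> (x t) = Suc (\<ll> (d \<circ> x t))" if "0 < t" "t \<le> n" for t
        using after[of t] that \<open>t0 = 0\<close> len_simple_cases[OF xW d(1), of t] by force
      \<comment> \<open>Multiplying the step from \<open>x 0\<close> to \<open>d \<circ> x 0\<close>
        by \<open>s\<close> on the right gives the step from \<open>w\<close> to
        \<open>d \<circ> w\<close>; it still goes up by the exclusion at the first step.\<close>
      have "\<not> \<ll> (d \<circ> w) < \<ll> w"
      proof
        assume lt: "\<ll> (d \<circ> w) < \<ll> w"
        have "d \<circ> x 0 \<noteq> x 0 \<circ> s" using ne[OF n] dx0 x0s by (auto simp: x_def)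
        moreover have "\<ll> (x 0) < \<ll> (d \<circ> x 0)" using dx0 xup[OF n] by simp
        ultimately have "\<ll> (x 0 \<circ> s) < \<ll> (d \<circ> x 0 \<circ> s)"
          by (rule refl_up_simple_right[OF xW sS dR(1)])
        then show False using lt x0s by (simp add: comp_assoc)
      qed
      then have low': "bruhat_le \<Phi> \<xi> w (d \<circ> x n)" using low by (simp add: lower_def)
      have y: "rchain (- \<alpha>) (- c - 1) t = d \<circ> rchain \<alpha> c (Suc t)" for t
        unfolding d1 by (rule rchain_uminus[OF \<alpha>])
      have x': "rchain (- \<alpha>) (- c - 1) t \<circ> w \<circ> s = d \<circ> x (Suc t)" for t
        unfolding y x_def comp_assoc ..
      have "\<not> bruhat_le \<Phi> \<xi> w (rchain (- \<alpha>) (- c - 1) n' \<circ> w \<circ> s)"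
      proof (rule less.hyps)
        show "\<ll> (rchain (- \<alpha>) (- c - 1) n' \<circ> w \<circ> s) < \<ll> (rchain \<alpha> c n \<circ> w \<circ> s)"
          using d(2) unfolding x' n' x_def .
        show "w \<in> W" "s \<in> S" "\<ll> (w \<circ> s) < \<ll> w" by (fact w sS ws)+
        show "- \<alpha> \<in> \<Phi>" by (rule uminus_root[OF \<alpha>])
        \<comment> \<open>The same strip, read with the opposite root.\<close>
        show "of_int (- c - 1) < w base \<bullet> - \<alpha>" "w base \<bullet> - \<alpha> < of_int (- c - 1) + 1"
          using strip by simp_all
        fix t assume t: "t < n'"
        show "\<ll> (rchain (- \<alpha>) (- c - 1) (Suc t) \<circ> w \<circ> s) = Suc (\<ll> (rchain (- \<alpha>) (- c - 1) t \<circ> w \<circ> s))"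
          unfolding x' using xup[of "Suc t"] all[of "Suc t"] all[of "Suc (Suc t)"] t n' by simp
        have "rchain (- \<alpha>) (- c - 1) t \<circ> w = d \<circ> (rchain \<alpha> c (Suc t) \<circ> w)" unfolding y comp_assoc ..
        then show "rchain (- \<alpha>) (- c - 1) (Suc t) \<circ> w \<circ> s \<noteq> rchain (- \<alpha>) (- c - 1) t \<circ> w"
          using ne[of "Suc t"] t n' refl_cancel[OF dR(1)] unfolding x' unfolding x_def by (metis Suc_less_eq)
      qed
      then show False using low' unfolding x' n' by simp
    qed
  qed
qed

end

theorem theorem1p4:
  fixes \<Phi> :: "'a::euclidean_space set" and \<xi> \<alpha> :: 'a
    and w s :: "'a \<Rightarrow> 'a" and c :: int and n :: nat
  assumes "DIM('a) = 2"
    and "root_system \<Phi>" and "irreducible_rs \<Phi>"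
    and "regular_vec \<Phi> \<xi>"
    and "w \<in> affW \<Phi>"
    and "s \<in> simple_refls \<Phi> \<xi>"
    and "len \<Phi> \<xi> (w \<circ> s) < len \<Phi> \<xi> w"
    and "\<alpha> \<in> \<Phi>" and "n \<ge> 1"
    and "\<forall>v \<in> w ` A0 \<Phi> \<xi>. of_int c < v \<bullet> \<alpha> \<and> v \<bullet> \<alpha> < of_int c + 1"
    and "\<forall>t\<in>{1..n}.
           len \<Phi> \<xi> (rchain \<alpha> c t \<circ> w \<circ> s) = len \<Phi> \<xi> (rchain \<alpha> c (t - 1) \<circ> w \<circ> s) + 1 \<and>
           rchain \<alpha> c t \<circ> w \<circ> s \<noteq> rchain \<alpha> c (t - 1) \<circ> w"
  shows "rchain \<alpha> c n \<circ> w \<circ> s \<in> annex \<Phi> \<xi> w"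
proof -
  interpret affine_weyl_plane \<Phi> \<xi> by unfold_locales fact+
  have strip: "of_int c < w base \<bullet> \<alpha>" "w base \<bullet> \<alpha> < of_int c + 1"
    using assms(10) base_in_A0 by auto
  \<comment> \<open>Steps numbered from 1 to n are renumbered from 0 to n - 1, which avoids
    truncated subtraction.\<close>
  have chain: "len \<Phi> \<xi> (rchain \<alpha> c (Suc t) \<circ> w \<circ> s) = Suc (len \<Phi> \<xi> (rchain \<alpha> c t \<circ> w \<circ> s))"
    "rchain \<alpha> c (Suc t) \<circ> w \<circ> s \<noteq> rchain \<alpha> c t \<circ> w" if "t < n" for t
    using bspec[OF assms(11), of "Suc t"] that by simp_all
  have "\<not> bruhat_le \<Phi> \<xi> w (rchain \<alpha> c n \<circ> w \<circ> s)"
    by (rule rchain_not_above[OF assms(5-8) strip chain])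
  moreover have "rchain \<alpha> c n \<circ> w \<circ> s \<in> affW \<Phi>"
    using W_comp rchain_W[OF assms(8)] assms(5) R_subset_W[OF S_subset_R[OF assms(6)]] by blast
  ultimately show ?thesis by (simp only: annex_def mem_Collect_eq simp_thms)
qed

end
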